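(* Let $D$ be a digraph. The topological space $|D|$ (with the topology DTop) is compact if and only if $D$ is solid.
   Context: Digraphs have no loops and no parallel edges; an edge is an ordered pair $vw$ with tail $v$ and head $w$. For a digraph $D$ let $\mathcal{X}(D)$ be the set of finite subsets of $V(D)$. $D$ is called solid if $D-X$ has only finitely many strong components for every $X\in\mathcal{X}(D)$. A ray is a one-way infinite directed path $v_0v_1v_2\dots$ (edges $v_iv_{i+1}$); its tails are its subrays. A ray is solid in $D$ if for every $X\in\mathcal{X}(D)$ it has a tail in some strong component of $D-X$. Two solid rays are equivalent if for every $X\in\mathcal{X}(D)$ they have tails in the same strong component of $D-X$; the equivalence classes are the ends of $D$, forming the set $\Omega(D)$. For an end $\omega$ and $X\in\mathcal{X}(D)$, $C(X,\omega)$ is the strong component of $D-X$ containing tails of the rays in $\omega$; we say $\omega$ lives in $C(X,\omega)$. $X$ separates ends $\omega,\eta$ if $C(X,\omega)\neq C(X,\eta)$. Limit edges: for distinct ends $\omega,\eta$, the pair $(\omega,\eta)$ is a limit edge (tail $\omega$, head $\eta$) if for every $X\in\mathcal{X}(D)$ separating $\omega$ and $\eta$, $D$ has an edge from $C(X,\omega)$ to $C(X,\eta)$. For a vertex $v$ and an end $\omega$, $(v,\omega)$ is a limit edge if $D$ has an edge from $v$ to $C(X,\omega)$ for every $X\in\mathcal{X}(D)$ with $v\notin C(X,\omega)$; $(\omega,v)$ is a limit edge if $D$ has an edge from $C(X,\omega)$ to $v$ for every such $X$. $\Lambda(D)$ is the set of limit edges. The space $|D|$: take $V(D)\cup\Omega(D)$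 and a copy $[0,1]_e$ of the unit interval for each $e\in E(D)\cup\Lambda(D)$, and identify the tail of $e$ with $0\in[0,1]_e$ and the head of $e$ with $1\in[0,1]_e$. The image of $[0,1]_e$ is an edge of $|D|$; points other than its endpoints are inner points. Inner points of two edges correspond if they come from the same real number. Given $X\in\mathcal{X}(D)$ and a strong component $C$ of $D-X$: a limit edge lives in $C$ if each of its endpoints is a vertex of $C$ or an end living in $C$. The topology DTop is generated by the following basic open sets ($0<\varepsilon<1$, always small enough to fit in the relevant edges): (1) for a vertex $v$: the open star consisting of $v$ together with $[0,\varepsilon)$ of every edge of $|D|$ with tail $v$ and $(1-\varepsilon,1]$ of every edge of $|D|$ with head $v$; (2) for an inner point $z$ of an edge $e\in E(D)$: open subintervals of the interior of $e$ containing $z$; (3) for an end $\omega$ and $X\in\mathcal{X}(D)$: the set $\hat C_\varepsilon(X,\omega)$, the union of the vertices and inner points of edges of $C(X,\omega)$, all ends living in $C(X,\omega)$, all points of limit edges living in $C(X,\omega)$, and, for every edge $e\in E(D)\cup\Lambda(D)$ having exactly one endpoint $y$ that is a vertex of or an end living in $C(X,\omega)$, the half-open segment of $e$ of length $\varepsilon$ at $y$ (including $y$); (4) for an inner point $z$ of a limit edge $(\omega,\eta)$ between ends and $X\in\mathcal{X}(D)$ separating $\omega,\eta$: the set $\hat E_{\varepsilon,z}(X,\omega\eta)$, the union of the open intervals of radius $\varepsilon$ around the points corresponding to $z$ on all edges of $D$ from $C(X,\omega)$ to $C(X,\eta)$ and on all limit edges whose tail is a vertex of or an end living in $C(X,\omega)$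 and whose head is a vertex of or an end living in $C(X,\eta)$; for an inner point $z$ of a limit edge $(v,\omega)$ and $X\in\mathcal{X}(D)$ with $v\in X$: the analogous union over all edges of $D$ from $v$ to $C(X,\omega)$ and all limit edges $(v,\omega')$ with $\omega'$ living in $C(X,\omega)$; and symmetrically for limit edges $(\omega,v)$. *)

theory Defs
  imports "HOL-Analysis.Analysis"
begin

definition digraph :: "'v set \<Rightarrow> ('v \<times> 'v) set \<Rightarrow> bool" where
  "digraph V E \<longleftrightarrow> E \<subseteq> V \<times> V \<and> (\<forall>v. (v, v) \<notin> E)"

definition fin_subsets :: "'v set \<Rightarrow> 'v set set" where
  "fin_subsets V = {X. X \<subseteq> V \<and> finite X}"

definition reach :: "'v set \<Rightarrow> ('v \<times> 'v) set \<Rightarrow> 'v set \<Rightarrow> 'v \<Rightarrow> 'v \<Rightarrow> bool" where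
  "reach V E X u w \<longleftrightarrow> (u, w) \<in> (E \<inter> ((V - X) \<times> (V - X)))\<^sup>*"

definition scomp :: "'v set \<Rightarrow> ('v \<times> 'v) set \<Rightarrow> 'v set \<Rightarrow> 'v \<Rightarrow> 'v set" where
  "scomp V E X u = {w \<in> V - X. reach V E X u w \<and> reach V E X w u}"

definition scomps :: "'v set \<Rightarrow> ('v \<times> 'v) set \<Rightarrow> 'v set \<Rightarrow> 'v set set" where
  "scomps V E X = {scomp V E X u | u. u \<in> V - X}"

definition solid :: "'v set \<Rightarrow> ('v \<times> 'v) set \<Rightarrow> bool" where
  "solid V E \<longleftrightarrow> (\<forall>X \<in> fin_subsets V. finite (scomps V E X))"

definition is_ray :: "'v set \<Rightarrow> ('v \<times> 'v) set \<Rightarrow> (nat \<Rightarrow> 'v) \<Rightarrow> bool" where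
  "is_ray V E r \<longleftrightarrow> inj r \<and> (\<forall>i. r i \<in> V \<and> (r i, r (Suc i)) \<in> E)"

definition tail_in :: "(nat \<Rightarrow> 'v) \<Rightarrow> 'v set \<Rightarrow> bool" where
  "tail_in r C \<longleftrightarrow> (\<exists>k. \<forall>i\<ge>k. r i \<in> C)"

definition solid_ray :: "'v set \<Rightarrow> ('v \<times> 'v) set \<Rightarrow> (nat \<Rightarrow> 'v) \<Rightarrow> bool" where
  "solid_ray V E r \<longleftrightarrow> is_ray V E r \<and>
     (\<forall>X \<in> fin_subsets V. \<exists>C \<in> scomps V E X. tail_in r C)"

definition ray_equiv :: "'v set \<Rightarrow> ('v \<times> 'v) set \<Rightarrow> (nat \<Rightarrow> 'v) \<Rightarrow> (nat \<Rightarrow> 'v) \<Rightarrow> bool" where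
  "ray_equiv V E r s \<longleftrightarrow> solid_ray V E r \<and> solid_ray V E s \<and>
     (\<forall>X \<in> fin_subsets V. \<exists>C \<in> scomps V E X. tail_in r C \<and> tail_in s C)"

definition ends :: "'v set \<Rightarrow> ('v \<times> 'v) set \<Rightarrow> (nat \<Rightarrow> 'v) set set" where
  "ends V E = {{s. ray_equiv V E r s} | r. solid_ray V E r}"

definition end_comp :: "'v set \<Rightarrow> ('v \<times> 'v) set \<Rightarrow> 'v set \<Rightarrow> (nat \<Rightarrow> 'v) set \<Rightarrow> 'v set" where
  "end_comp V E X \<omega> = (THE C. C \<in> scomps V E X \<and> (\<forall>r \<in> \<omega>. tail_in r C))"

datatype 'v node = NV 'v | NE "(nat \<Rightarrow> 'v) set"

definition nodes :: "'v set \<Rightarrow> ('v \<times> 'v) set \<Rightarrow> 'v node set" where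
  "nodes V E = NV ` V \<union> NE ` ends V E"

definition node_in :: "'v set \<Rightarrow> ('v \<times> 'v) set \<Rightarrow> 'v set \<Rightarrow> 'v set \<Rightarrow> 'v node \<Rightarrow> bool" where
  "node_in V E X C n = (case n of NV u \<Rightarrow> u \<in> C
       | NE \<omega> \<Rightarrow> \<omega> \<in> ends V E \<and> end_comp V E X \<omega> = C)"

definition limit_edges :: "'v set \<Rightarrow> ('v \<times> 'v) set \<Rightarrow> ('v node \<times> 'v node) set" where
  "limit_edges V E =
     {(NE \<omega>, NE \<eta>) | \<omega> \<eta>. \<omega> \<in> ends V E \<and> \<eta> \<in> ends V E \<and> \<omega> \<noteq> \<eta> \<and>
        (\<forall>X \<in> fin_subsets V. end_comp V E X \<omega> \<noteq> end_comp V E X \<eta> \<longrightarrow>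
           (\<exists>u w. (u, w) \<in> E \<and> u \<in> end_comp V E X \<omega> \<and> w \<in> end_comp V E X \<eta>))}
   \<union> {(NV v, NE \<omega>) | v \<omega>. v \<in> V \<and> \<omega> \<in> ends V E \<and>
        (\<forall>X \<in> fin_subsets V. v \<notin> end_comp V E X \<omega> \<longrightarrow>
           (\<exists>w. (v, w) \<in> E \<and> w \<in> end_comp V E X \<omega>))}
   \<union> {(NE \<omega>, NV v) | v \<omega>. v \<in> V \<and> \<omega> \<in> ends V E \<and>
        (\<forall>X \<in> fin_subsets V. v \<notin> end_comp V E X \<omega> \<longrightarrow>
           (\<exists>u. (u, v) \<in> E \<and> u \<in> end_comp V E X \<omega>))}"

definition all_edges :: "'v set \<Rightarrow> ('v \<times> 'v) set \<Rightarrow> ('v node \<times> 'v node) set" where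
  "all_edges V E = {(NV u, NV w) | u w. (u, w) \<in> E} \<union> limit_edges V E"

text \<open>Points of |D|: nodes, and inner points (e, t) with 0 < t < 1 of edges e
  (the endpoints 0 and 1 of the edge e being identified with tail and head of e).\<close>
datatype 'v dpoint = PN "'v node" | PI "'v node \<times> 'v node" real

definition star :: "'v set \<Rightarrow> ('v \<times> 'v) set \<Rightarrow> 'v \<Rightarrow> real \<Rightarrow> 'v dpoint set" where
  "star V E v \<epsilon> = {PN (NV v)}
     \<union> {PI e t | e t. e \<in> all_edges V E \<and> fst e = NV v \<and> 0 < t \<and> t < \<epsilon>}
     \<union> {PI e t | e t. e \<in> all_edges V E \<and> snd e = NV v \<and> 1 - \<epsilon> < t \<and> t < 1}"

definition chat :: "'v set \<Rightarrow> ('v \<times> 'v) set \<Rightarrow> real \<Rightarrow> 'v set \<Rightarrow> (nat \<Rightarrow> 'v) set \<Rightarrow> 'v dpoint set" where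
  "chat V E \<epsilon> X \<omega> = (let C = end_comp V E X \<omega>; inC = node_in V E X C in
       {PN n | n. n \<in> nodes V E \<and> inC n}
     \<union> {PI e t | e t. e \<in> all_edges V E \<and> inC (fst e) \<and> inC (snd e) \<and> 0 < t \<and> t < 1}
     \<union> {PI e t | e t. e \<in> all_edges V E \<and> inC (fst e) \<and> \<not> inC (snd e) \<and> 0 < t \<and> t < \<epsilon>}
     \<union> {PI e t | e t. e \<in> all_edges V E \<and> \<not> inC (fst e) \<and> inC (snd e) \<and> 1 - \<epsilon> < t \<and> t < 1})"

definition edge_nbhd :: "'v set \<Rightarrow> ('v \<times> 'v) set \<Rightarrow> ('v node \<times> 'v node \<Rightarrow> bool) \<Rightarrow> real \<Rightarrow> real \<Rightarrow> 'v dpoint set" where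
  "edge_nbhd V E F \<epsilon> z = {PI e t | e t. e \<in> all_edges V E \<and> F e \<and> \<bar>t - z\<bar> < \<epsilon>}"

definition dtop_basis :: "'v set \<Rightarrow> ('v \<times> 'v) set \<Rightarrow> 'v dpoint set set" where
  "dtop_basis V E =
     {star V E v \<epsilon> | v \<epsilon>. v \<in> V \<and> 0 < \<epsilon> \<and> \<epsilon> < 1}
   \<union> {{PI e t | t. a < t \<and> t < b} | e a b. e \<in> all_edges V E \<and> fst e \<in> NV ` V \<and> snd e \<in> NV ` V
        \<and> 0 \<le> a \<and> a < b \<and> b \<le> 1}
   \<union> {chat V E \<epsilon> X \<omega> | \<epsilon> X \<omega>. \<omega> \<in> ends V E \<and> X \<in> fin_subsets V \<and> 0 < \<epsilon> \<and> \<epsilon> < 1}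
   \<union> {edge_nbhd V E (\<lambda>e. node_in V E X (end_comp V E X \<omega>) (fst e) \<and>
                         node_in V E X (end_comp V E X \<eta>) (snd e)) \<epsilon> z
        | \<omega> \<eta> X \<epsilon> z. (NE \<omega>, NE \<eta>) \<in> limit_edges V E \<and> X \<in> fin_subsets V \<and>
            end_comp V E X \<omega> \<noteq> end_comp V E X \<eta> \<and> 0 < z \<and> z < 1 \<and> 0 < \<epsilon> \<and> \<epsilon> \<le> min z (1 - z)}
   \<union> {edge_nbhd V E (\<lambda>e. fst e = NV v \<and> node_in V E X (end_comp V E X \<omega>) (snd e)) \<epsilon> z
        | v \<omega> X \<epsilon> z. (NV v, NE \<omega>) \<in> limit_edges V E \<and> X \<in> fin_subsets V \<and> v \<in> X \<and>
            0 < z \<and> z < 1 \<and> 0 < \<epsilon> \<and> \<epsilon> \<le> min z (1 - z)}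
   \<union> {edge_nbhd V E (\<lambda>e. node_in V E X (end_comp V E X \<omega>) (fst e) \<and> snd e = NV v) \<epsilon> z
        | v \<omega> X \<epsilon> z. (NE \<omega>, NV v) \<in> limit_edges V E \<and> X \<in> fin_subsets V \<and> v \<in> X \<and>
            0 < z \<and> z < 1 \<and> 0 < \<epsilon> \<and> \<epsilon> \<le> min z (1 - z)}"

definition DTop :: "'v set \<Rightarrow> ('v \<times> 'v) set \<Rightarrow> 'v dpoint topology" where
  "DTop V E = topology_generated_by (dtop_basis V E)"

end

theory Submission
  imports Defs
begin

text \<open>
  If deleting a finite set $X$ leaves infinitely many strong components, pick one vertex from each:
  every point has a basic neighbourhood containing at most one of them, which rules out compactness.

  Conversely, let $D$ be solid; it suffices that every ultrafilter on $|D|$ converges. An ultrafilter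
  on the nodes that is not principal at a vertex selects, for each finite $X$, one of the finitely
  many strong components of $D - X$. This choice is a direction, and every direction comes from an end.
  An ultrafilter on inner points of edges has a limit of the tails, a limit of the heads and a limit
  of the real coordinates, and these three determine its limit point.

  To find the end inducing a direction $f$, one finds a countable set of vertices meeting every
  $f(X)$, closes it up under finite paths inside the sets $f(X)$, and takes a ray in the resulting
  countable set $H$ that converges to $f$ with respect to the finite subsets of $H$.
\<close>

section \<open>Strong components\<close>

text \<open>The obstacle is that \<open>V\<close> may be uncountable: a ray is countable, yet it has
  to follow a direction past every finite vertex set. So the direction must be caught by countably
  many vertices, and there are two reasons why it can be. Either there are infinitely many disjoint
  finite sets, each of which the direction meets unless some of its vertices are deleted; or
  countably many deletions drive the direction away from every single vertex. The result on
  directions holds in every digraph; solidity enters only to let an ultrafilter choose among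
  finitely many components.

  Ultrafilters fit because a basic open set restricts an inner point only through its tail, its head
  and its coordinate, so the three limits can be taken separately. The definition of limit edges is
  what makes the pair of limits an edge of the space: edges that eventually run between two
  components provide the edges of the digraph that a limit edge demands. The one exception is that
  tails and heads converge to the same end; then that end is the limit for every value of the
  coordinate.\<close>

lemma scomp_self: "u \<in> V - X \<Longrightarrow> u \<in> scomp V E X u"
  by (simp add: scomp_def reach_def)

lemma scomp_eq: "w \<in> scomp V E X u \<Longrightarrow> scomp V E X w = scomp V E X u"
  unfolding scomp_def reach_def by (blast intro: rtrancl_trans)

lemma scomps_eq_scomp: "C \<in> scomps V E X \<Longrightarrow> u \<in> C \<Longrightarrow> C = scomp V E X u"
  unfolding scomps_def using scomp_eq by fastforce

lemma scomps_subset: "C \<in> scomps V E X \<Longrightarrow> C \<subseteq> V - X"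
  unfolding scomps_def scomp_def by auto

lemma scomps_nonempty: "C \<in> scomps V E X \<Longrightarrow> C \<noteq> {}"
  unfolding scomps_def using scomp_self by fastforce

lemma scomps_disjoint:
  "C \<in> scomps V E X \<Longrightarrow> D \<in> scomps V E X \<Longrightarrow> u \<in> C \<Longrightarrow> u \<in> D \<Longrightarrow> C = D"
  using scomps_eq_scomp by metis

lemma scomps_cover: "u \<in> V - X \<Longrightarrow> \<exists>C\<in>scomps V E X. u \<in> C"
  using scomp_self unfolding scomps_def by fastforce

lemma reach_antimono: "X \<subseteq> Y \<Longrightarrow> reach V E Y u w \<Longrightarrow> reach V E X u w"
  unfolding reach_def by (rule rtrancl_mono[THEN subsetD]) auto

lemma scomps_antimono:
  assumes "X \<subseteq> Y" "C \<in> scomps V E X" "D \<in> scomps V E Y" "u \<in> C" "u \<in> D"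
  shows "D \<subseteq> C"
  using assms scomps_eq_scomp[of C V E X u] scomps_eq_scomp[of D V E Y u]
  unfolding scomp_def by (auto intro: reach_antimono)

text \<open>The relation of lying in one strong component of the subdigraph induced on
  \<open>A\<close>. The host set is arbitrary, unlike in \<open>scomp\<close>, so that finite closed
  walks and the countable set \<open>H\<close> can serve as hosts.\<close>

definition strongly_linked :: "('v \<times> 'v) set \<Rightarrow> 'v set \<Rightarrow> 'v \<Rightarrow> 'v \<Rightarrow> bool" where
  "strongly_linked E A u w \<longleftrightarrow>
     u \<in> A \<and> w \<in> A \<and> (u, w) \<in> (E \<inter> A \<times> A)\<^sup>* \<and> (w, u) \<in> (E \<inter> A \<times> A)\<^sup>*"

lemma strongly_linked_mono:
  "strongly_linked E A u w \<Longrightarrow> A \<subseteq> B \<Longrightarrow> strongly_linked E B u w"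
  unfolding strongly_linked_def
  by (meson Int_mono Sigma_mono order_refl rtrancl_mono subsetD)

lemma strongly_linked_scomp:
  assumes "strongly_linked E A u w" "A \<subseteq> V - X"
  shows "w \<in> scomp V E X u"
  using strongly_linked_mono[OF assms] assms
  unfolding strongly_linked_def scomp_def reach_def by auto

lemma strongly_linked_scomps:
  assumes "strongly_linked E A u w" "A \<subseteq> V - X" "C \<in> scomps V E X" "u \<in> C"
  shows "w \<in> C"
  using strongly_linked_scomp[OF assms(1,2)] scomps_eq_scomp[OF assms(3,4)] by simp

text \<open>A vertex on the walk reaches \<open>w\<close> and hence \<open>u\<close> again, so the
  walk cannot leave the component of \<open>u\<close>. The induction carries the way back as a
  premise.\<close>

lemma rtrancl_within_scomp:
  assumes "(u, w) \<in> (E \<inter> (V - X) \<times> (V - X))\<^sup>*" "reach V E X w u" "u \<in> V - X"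
  shows "(u, w) \<in> (E \<inter> scomp V E X u \<times> scomp V E X u)\<^sup>*"
  using assms
proof (induction rule: rtrancl_induct)
  case base
  then show ?case by simp
next
  case (step y z)
  have yz: "reach V E X y z" "reach V E X u y" "reach V E X u z"
    using step.hyps rtrancl_into_rtrancl[OF step.hyps] unfolding reach_def by (blast+)
  have "reach V E X y u"
    using rtrancl_trans yz(1) step.prems(1) unfolding reach_def by fast
  moreover from this have "y \<in> scomp V E X u" "z \<in> scomp V E X u"
    using step.hyps step.prems yz unfolding scomp_def by auto
  ultimately show ?case
    using step.hyps step.IH step.prems by (auto intro: rtrancl_into_rtrancl)
qed

lemma scomps_strongly_linked:
  assumes "C \<in> scomps V E X" "u \<in> C" "w \<in> C"
  shows "strongly_linked E C u w"
proof -
  have eq: "C = scomp V E X u" "C = scomp V E X w"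
    using assms scomps_eq_scomp by metis+
  have sub: "u \<in> V - X" "w \<in> V - X" using assms scomps_subset[OF assms(1)] by auto
  have r: "reach V E X u w" "reach V E X w u" using eq(1) assms(3) unfolding scomp_def by auto
  have "(u, w) \<in> (E \<inter> C \<times> C)\<^sup>*"
    using rtrancl_within_scomp[of u w E V X] r sub(1) eq(1) by (simp add: reach_def)
  moreover have "(w, u) \<in> (E \<inter> C \<times> C)\<^sup>*"
    using rtrancl_within_scomp[of w u E V X] r sub(2) eq(2) by (simp add: reach_def)
  ultimately show ?thesis using assms unfolding strongly_linked_def by simp
qed

lemma rtrancl_finite_support:
  assumes "(u, w) \<in> R\<^sup>*"
  shows "\<exists>W. finite W \<and> u \<in> W \<and> w \<in> W \<and> (u, w) \<in> (R \<inter> W \<times> W)\<^sup>*"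
  using assms
proof (induction rule: rtrancl_induct)
  case base
  show ?case by (rule exI[of _ "{u}"]) simp
next
  case (step y z)
  then obtain W where W: "finite W" "u \<in> W" "y \<in> W" "(u, y) \<in> (R \<inter> W \<times> W)\<^sup>*" by blast
  have "(u, y) \<in> (R \<inter> insert z W \<times> insert z W)\<^sup>*"
    by (rule rtrancl_mono[THEN subsetD, OF _ W(4)]) auto
  then have "(u, z) \<in> (R \<inter> insert z W \<times> insert z W)\<^sup>*"
    using step.hyps W by (auto intro: rtrancl_into_rtrancl)
  then show ?case using W by (intro exI[of _ "insert z W"]) auto
qed

text \<open>A walk there and a walk back use finitely many vertices. Such a finite witness survives
  every deletion that misses it.\<close>

lemma strongly_linked_finite_support:
  assumes "strongly_linked E A u w"
  shows "\<exists>W. finite W \<and> W \<subseteq> A \<and> strongly_linked E W u w"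
proof -
  have uw: "u \<in> A" "w \<in> A" using assms by (auto simp: strongly_linked_def)
  obtain W1 W2 where W: "finite W1" "u \<in> W1" "w \<in> W1" "(u, w) \<in> (E \<inter> A \<times> A \<inter> W1 \<times> W1)\<^sup>*"
    "finite W2" "u \<in> W2" "w \<in> W2" "(w, u) \<in> (E \<inter> A \<times> A \<inter> W2 \<times> W2)\<^sup>*"
    using assms rtrancl_finite_support[of u w] rtrancl_finite_support[of w u]
    unfolding strongly_linked_def by metis
  define W where "W = (W1 \<union> W2) \<inter> A"
  have "(u, w) \<in> (E \<inter> W \<times> W)\<^sup>*"
    by (rule rtrancl_mono[THEN subsetD, OF _ W(4)]) (auto simp: W_def)
  moreover have "(w, u) \<in> (E \<inter> W \<times> W)\<^sup>*"
    by (rule rtrancl_mono[THEN subsetD, OF _ W(8)]) (auto simp: W_def)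
  ultimately have "strongly_linked E W u w"
    using W uw by (auto simp: strongly_linked_def W_def)
  then show ?thesis using W by (intro exI[of _ W]) (auto simp: W_def)
qed

section \<open>Ends\<close>

lemma tail_in_meet: "tail_in r C \<Longrightarrow> tail_in r D \<Longrightarrow> \<exists>i. r i \<in> C \<and> r i \<in> D"
  unfolding tail_in_def using max.cobounded1 max.cobounded2 by fast

lemma tail_in_unique:
  "C \<in> scomps V E X \<Longrightarrow> D \<in> scomps V E X \<Longrightarrow> tail_in r C \<Longrightarrow> tail_in r D \<Longrightarrow> C = D"
  using scomps_disjoint[of C V E X D] tail_in_meet[of r C D] by auto

lemma ray_equiv_refl: "solid_ray V E r \<Longrightarrow> ray_equiv V E r r"
  unfolding ray_equiv_def solid_ray_def by auto

lemma ray_equiv_sym: "ray_equiv V E r s \<Longrightarrow> ray_equiv V E s r"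
  unfolding ray_equiv_def by blast

lemma ray_equiv_trans:
  assumes rs: "ray_equiv V E r s" and st: "ray_equiv V E s t"
  shows "ray_equiv V E r t"
  unfolding ray_equiv_def
proof (intro conjI ballI)
  fix X
  assume X: "X \<in> fin_subsets V"
  obtain C where C: "C \<in> scomps V E X" "tail_in r C" "tail_in s C"
    using rs X unfolding ray_equiv_def by blast
  obtain D where D: "D \<in> scomps V E X" "tail_in s D" "tail_in t D"
    using st X unfolding ray_equiv_def by blast
  show "\<exists>C\<in>scomps V E X. tail_in r C \<and> tail_in t C"
    using C D tail_in_unique[OF C(1) D(1) C(3) D(2)] by blast
qed (use rs st in \<open>auto simp: ray_equiv_def\<close>)

text \<open>The description in \<open>end_comp\<close> is well defined: equivalent rays have tails
  in a common component, and a ray has tails in only one, so any representative determines the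
  component of the whole end.\<close>

lemma end_comp_eqI:
  assumes "solid_ray V E r" "X \<in> fin_subsets V" "C \<in> scomps V E X" "tail_in r C"
  shows "end_comp V E X {s. ray_equiv V E r s} = C"
  unfolding end_comp_def
proof (rule the_equality)
  have "tail_in s C" if rs: "ray_equiv V E r s" for s
  proof -
    obtain D where D: "D \<in> scomps V E X" "tail_in r D" "tail_in s D"
      using rs assms(2) unfolding ray_equiv_def by blast
    then show ?thesis using tail_in_unique[OF assms(3) D(1) assms(4) D(2)] by simp
  qed
  then show "C \<in> scomps V E X \<and> (\<forall>s\<in>{s. ray_equiv V E r s}. tail_in s C)"
    using assms by auto
  show "D = C" if "D \<in> scomps V E X \<and> (\<forall>s\<in>{s. ray_equiv V E r s}. tail_in s D)" for D
    using that assms ray_equiv_refl[OF assms(1)] tail_in_unique[of D V E X C r] by blast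
qed

lemma endsE:
  assumes "\<omega> \<in> ends V E"
  obtains r where "solid_ray V E r" "\<omega> = {s. ray_equiv V E r s}"
    "\<And>X. X \<in> fin_subsets V \<Longrightarrow> end_comp V E X \<omega> \<in> scomps V E X \<and> tail_in r (end_comp V E X \<omega>)"
proof -
  obtain r where r: "solid_ray V E r" "\<omega> = {s. ray_equiv V E r s}"
    using assms unfolding ends_def by auto
  then have "end_comp V E X \<omega> \<in> scomps V E X \<and> tail_in r (end_comp V E X \<omega>)"
    if "X \<in> fin_subsets V" for X
    using end_comp_eqI[OF r(1) that] that unfolding solid_ray_def by auto
  with r that show thesis by blast
qed

lemma end_comp_scomps:
  "\<omega> \<in> ends V E \<Longrightarrow> X \<in> fin_subsets V \<Longrightarrow> end_comp V E X \<omega> \<in> scomps V E X"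
  by (erule endsE) simp

lemma end_comp_antimono:
  assumes "\<omega> \<in> ends V E" "X \<in> fin_subsets V" "Y \<in> fin_subsets V" "X \<subseteq> Y"
  shows "end_comp V E Y \<omega> \<subseteq> end_comp V E X \<omega>"
proof -
  obtain r where r: "\<And>X. X \<in> fin_subsets V \<Longrightarrow>
      end_comp V E X \<omega> \<in> scomps V E X \<and> tail_in r (end_comp V E X \<omega>)"
    using endsE[OF assms(1)] by metis
  then obtain i where "r i \<in> end_comp V E X \<omega>" "r i \<in> end_comp V E Y \<omega>"
    using assms tail_in_meet by metis
  then show ?thesis using scomps_antimono[OF assms(4)] r assms(2,3) by metis
qed

lemma ends_separated:
  assumes "\<omega> \<in> ends V E" "\<eta> \<in> ends V E" "\<omega> \<noteq> \<eta>"
  shows "\<exists>X\<in>fin_subsets V. end_comp V E X \<omega> \<noteq> end_comp V E X \<eta>"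
proof (rule ccontr)
  assume eq: "\<not> ?thesis"
  obtain r where r: "solid_ray V E r" "\<omega> = {s. ray_equiv V E r s}"
    "\<And>X. X \<in> fin_subsets V \<Longrightarrow> end_comp V E X \<omega> \<in> scomps V E X \<and> tail_in r (end_comp V E X \<omega>)"
    using endsE[OF assms(1)] by metis
  obtain r' where r': "solid_ray V E r'" "\<eta> = {s. ray_equiv V E r' s}"
    "\<And>X. X \<in> fin_subsets V \<Longrightarrow> end_comp V E X \<eta> \<in> scomps V E X \<and> tail_in r' (end_comp V E X \<eta>)"
    using endsE[OF assms(2)] by metis
  have rr': "ray_equiv V E r r'"
    unfolding ray_equiv_def using r(1,3) r'(1,3) eq by metis
  have "ray_equiv V E r s \<longleftrightarrow> ray_equiv V E r' s" for s
    using ray_equiv_trans[OF rr'] ray_equiv_trans[OF ray_equiv_sym[OF rr']] by blast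
  with assms(3) r(2) r'(2) show False by simp
qed

section \<open>Directions are induced by ends\<close>

lemma disjoint_family_finite_miss:
  fixes B :: "nat \<Rightarrow> 'a set"
  assumes "disjoint_family B" "finite X"
  shows "\<exists>n. B n \<inter> X = {}"
proof (rule ccontr)
  assume "\<not> ?thesis"
  then have "\<forall>n. \<exists>x. x \<in> B n \<inter> X" by auto
  then obtain x where x: "\<And>n. x n \<in> B n \<inter> X" by metis
  have "inj x"
  proof (rule injI)
    fix m n
    assume "x m = x n"
    then show "m = n" using x[of m] x[of n] assms(1) unfolding disjoint_family_on_def by auto
  qed
  moreover have "range x \<subseteq> X" using x by auto
  ultimately show False using assms(2) finite_subset range_inj_infinite by metis
qed

text \<open>The step function sees everything collected so far. If it always avoids its argument,
  its successive values are pairwise disjoint; otherwise the iteration serves as a closure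
  process.\<close>

primrec accumulate :: "('a set \<Rightarrow> 'a set) \<Rightarrow> 'a set \<Rightarrow> nat \<Rightarrow> 'a set" where
  "accumulate g A 0 = A"
| "accumulate g A (Suc n) = accumulate g A n \<union> g (accumulate g A n)"

lemma accumulate_mono: "m \<le> n \<Longrightarrow> accumulate g A m \<subseteq> accumulate g A n"
  by (rule lift_Suc_mono_le[of "accumulate g A"]) auto

lemma accumulate_increment_subset: "m < n \<Longrightarrow> g (accumulate g A m) \<subseteq> accumulate g A n"
  using accumulate_mono[of "Suc m" n g A] by auto

lemma accumulate_disjoint_family:
  assumes "\<And>n. g (accumulate g A n) \<inter> accumulate g A n = {}"
  shows "disjoint_family (\<lambda>n. g (accumulate g A n))"
  unfolding disjoint_family_on_def
proof (intro ballI impI)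
  fix m n :: nat
  assume "m \<noteq> n"
  then show "g (accumulate g A m) \<inter> g (accumulate g A n) = {}"
    using assms accumulate_increment_subset[of m n g A] accumulate_increment_subset[of n m g A]
    by (cases "m < n") fastforce+
qed

section \<open>Directions and countable sets that they meet\<close>

locale direction =
  fixes V :: "'v set" and E :: "('v \<times> 'v) set" and f :: "'v set \<Rightarrow> 'v set"
  assumes scomps: "X \<in> fin_subsets V \<Longrightarrow> f X \<in> scomps V E X"
    and antimono: "X \<in> fin_subsets V \<Longrightarrow> Y \<in> fin_subsets V \<Longrightarrow> X \<subseteq> Y \<Longrightarrow> f Y \<subseteq> f X"
begin

lemma nonempty: "X \<in> fin_subsets V \<Longrightarrow> f X \<noteq> {}"
  using scomps scomps_nonempty by metis

lemma subset: "X \<in> fin_subsets V \<Longrightarrow> f X \<subseteq> V - X"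
  using scomps scomps_subset by metis

text \<open>\<open>f Y\<close> is strongly connected, so once it avoids \<open>X\<close> it lies in
  a single component left by deleting \<open>X\<close>. The nonempty set
  \<open>f (X \<union> Y)\<close> is contained in both \<open>f X\<close> and \<open>f Y\<close>,
  which identifies that component as \<open>f X\<close>.\<close>

lemma subset_if_disjoint:
  assumes X: "X \<in> fin_subsets V" and Y: "Y \<in> fin_subsets V" and "f Y \<inter> X = {}"
  shows "f Y \<subseteq> f X"
proof
  fix w
  assume w: "w \<in> f Y"
  have XY: "X \<union> Y \<in> fin_subsets V" using X Y by (auto simp: fin_subsets_def)
  then obtain u where "u \<in> f (X \<union> Y)" using nonempty by blast
  then have u: "u \<in> f X" "u \<in> f Y"
    using antimono[OF X XY] antimono[OF Y XY] by auto
  have "f Y \<subseteq> V - X" using subset[OF Y] assms(3) by auto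
  then show "w \<in> f X"
    using strongly_linked_scomps[OF scomps_strongly_linked[OF scomps[OF Y] u(2) w]]
      scomps[OF X] u by blast
qed

lemma exists_countable_hitting_set:
  "\<exists>U. countable U \<and> U \<subseteq> V \<and> (\<forall>X\<in>fin_subsets V. f X \<inter> U \<noteq> {})"
proof (cases "\<forall>X\<in>fin_subsets V. \<exists>F\<in>fin_subsets V. F \<inter> X = {} \<and>
    (\<forall>Z\<in>fin_subsets V. Z \<inter> F = {} \<longrightarrow> f (Z \<union> X) \<inter> F \<noteq> {})")
  case True
  \<comment> \<open>Every finite set is disjoint from one that can only be avoided by deleting some of its own
    vertices; a sequence of disjoint sets of this kind has the required union.\<close>
  then obtain \<Phi> where \<Phi>: "\<And>X. X \<in> fin_subsets V \<Longrightarrow> \<Phi> X \<in> fin_subsets V \<and> \<Phi> X \<inter> X = {} \<and>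
    (\<forall>Z\<in>fin_subsets V. Z \<inter> \<Phi> X = {} \<longrightarrow> f (Z \<union> X) \<inter> \<Phi> X \<noteq> {})"
    by metis
  define A where "A = accumulate \<Phi> {}"
  have A: "A n \<in> fin_subsets V" for n
  proof (induction n)
    case (Suc n)
    then show ?case using \<Phi>[OF Suc] by (auto simp: A_def fin_subsets_def)
  qed (simp add: A_def fin_subsets_def)
  have "f X \<inter> (\<Union>n. A n) \<noteq> {}" if X: "X \<in> fin_subsets V" for X
  proof -
    have "disjoint_family (\<lambda>n. \<Phi> (A n))"
      unfolding A_def by (rule accumulate_disjoint_family) (use \<Phi> A in \<open>auto simp: A_def\<close>)
    then obtain n where "\<Phi> (A n) \<inter> X = {}"
      using disjoint_family_finite_miss X unfolding fin_subsets_def by blast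
    \<comment> \<open>The chosen \<open>\<Phi> (A n)\<close> misses \<open>X\<close>, so its
      defining property applies with \<open>Z = X\<close>.\<close>
    then have "f (X \<union> A n) \<inter> \<Phi> (A n) \<noteq> {}" using \<Phi>[OF A[of n]] X by blast
    moreover have "f (X \<union> A n) \<subseteq> f X"
      using X A[of n] by (intro antimono) (auto simp: fin_subsets_def)
    moreover have "\<Phi> (A n) \<subseteq> A (Suc n)" by (simp add: A_def)
    ultimately show ?thesis by blast
  qed
  moreover have "countable (A n)" "A n \<subseteq> V" for n
    using A[of n] by (auto simp: fin_subsets_def intro: countable_finite)
  then have "countable (\<Union>n. A n)" "(\<Union>n. A n) \<subseteq> V" by auto
  ultimately show ?thesis by blast
next
  case False
  \<comment> \<open>Now \<open>f\<close> can be pushed away from any finite set by deleting vertices outside that set, up to a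
    fixed \<open>X'\<close>. Do so repeatedly with disjoint sets \<open>\<Psi> (A n)\<close>: all but finitely many of them miss a given
    finite closed walk through \<open>u\<close>, so each vertex of \<open>f X'\<close> lies in only finitely many \<open>f (Y n)\<close>.\<close>
  then obtain X' where X': "X' \<in> fin_subsets V" and
    *: "\<And>F. F \<in> fin_subsets V \<Longrightarrow> F \<inter> X' = {} \<Longrightarrow>
      \<exists>Z\<in>fin_subsets V. Z \<inter> F = {} \<and> f (Z \<union> X') \<inter> F = {}"
    by meson
  \<comment> \<open>Replacing \<open>Z\<close> by \<open>Z - X'\<close> leaves
    \<open>Z \<union> X'\<close> unchanged and keeps the accumulated sets disjoint from
    \<open>X'\<close>, as the next application of the property requires.\<close>
  have "\<exists>Z\<in>fin_subsets V. Z \<inter> X' = {} \<and> Z \<inter> F = {} \<and> f (Z \<union> X') \<inter> F = {}"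
    if F: "F \<in> fin_subsets V" "F \<inter> X' = {}" for F
  proof -
    obtain Z where "Z \<in> fin_subsets V" "Z \<inter> F = {}" "f (Z \<union> X') \<inter> F = {}"
      using *[OF F] by auto
    then show ?thesis
      by (intro bexI[of _ "Z - X'"]) (auto simp: fin_subsets_def)
  qed
  then obtain \<Psi> where \<Psi>: "\<And>F. F \<in> fin_subsets V \<Longrightarrow> F \<inter> X' = {} \<Longrightarrow>
      \<Psi> F \<in> fin_subsets V \<and> \<Psi> F \<inter> X' = {} \<and> \<Psi> F \<inter> F = {} \<and> f (\<Psi> F \<union> X') \<inter> F = {}"
    by metis
  obtain u where u: "u \<in> f X'" using nonempty[OF X'] by blast
  \<comment> \<open>Starting from \<open>{u}\<close> puts \<open>u\<close> into every
    \<open>A n\<close>, so that no \<open>f (Y n)\<close> contains \<open>u\<close>.\<close>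
  define A where "A = accumulate \<Psi> {u}"
  have A: "A n \<in> fin_subsets V \<and> A n \<inter> X' = {}" for n
  proof (induction n)
    case 0
    then show ?case using u subset[OF X'] by (auto simp: A_def fin_subsets_def)
  next
    case (Suc n)
    then show ?case using \<Psi>[of "A n"] by (auto simp: A_def fin_subsets_def)
  qed
  define Y where "Y n = \<Psi> (A n) \<union> X'" for n
  have Y: "Y n \<in> fin_subsets V" for n
    using \<Psi>[of "A n"] A[of n] X' by (auto simp: Y_def fin_subsets_def)
  have "u \<in> A n" for n
    using accumulate_mono[of 0 n \<Psi> "{u}"] by (auto simp: A_def)
  then have unotin: "u \<notin> f (Y n)" for n
    using \<Psi>[of "A n"] A[of n] by (auto simp: Y_def)
  have "\<exists>y. y \<in> f (Y n)" for n using nonempty[OF Y] by auto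
  then obtain y where y: "\<And>n. y n \<in> f (Y n)" by metis
  have "f X \<inter> range y \<noteq> {}" if X: "X \<in> fin_subsets V" for X
  proof -
    have "\<exists>W. finite W \<and> W \<subseteq> f X' \<and> strongly_linked E W x u" if "x \<in> f X'" for x
      using strongly_linked_finite_support scomps_strongly_linked[OF scomps[OF X'] that u]
      by metis
    then obtain W where W: "\<And>x. x \<in> f X' \<Longrightarrow>
        finite (W x) \<and> W x \<subseteq> f X' \<and> strongly_linked E (W x) x u" by metis
    \<comment> \<open>One finite witness is taken for each of the finitely many vertices in
      question, so a single \<open>n\<close> serves them all.\<close>
    have "finite (\<Union>x\<in>X \<inter> f X'. W x)" using X W by (auto simp: fin_subsets_def)
    moreover have "disjoint_family (\<lambda>n. \<Psi> (A n))"
      unfolding A_def by (rule accumulate_disjoint_family) (use \<Psi> A in \<open>auto simp: A_def\<close>)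
    ultimately obtain n where n: "\<Psi> (A n) \<inter> (\<Union>x\<in>X \<inter> f X'. W x) = {}"
      using disjoint_family_finite_miss by blast
    have "f (Y n) \<inter> X = {}"
    proof (rule ccontr)
      assume "\<not> ?thesis"
      then obtain x where x: "x \<in> f (Y n)" "x \<in> X" by auto
      then have x': "x \<in> f X'" using antimono[OF X' Y[of n]] by (auto simp: Y_def)
      \<comment> \<open>\<open>W x\<close> misses \<open>\<Psi> (A n)\<close> by the choice of
        \<open>n\<close>, and \<open>X'\<close> because it lies in \<open>f X'\<close>; hence it
        still links \<open>x\<close> to \<open>u\<close> after deletion of
        \<open>Y n\<close>.\<close>
      then have "W x \<subseteq> V - Y n"
        using W[OF x'] n x subset[OF X'] by (auto simp: Y_def)
      then have "u \<in> f (Y n)"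
        using strongly_linked_scomps[of E "W x" x u V "Y n"] W[OF x'] scomps[OF Y] x by blast
      with unotin show False by blast
    qed
    then have "f (Y n) \<subseteq> f X" using subset_if_disjoint X Y by blast
    then show ?thesis using y by blast
  qed
  moreover have "range y \<subseteq> V" using y subset[OF Y] by blast
  ultimately show ?thesis by (intro exI[of _ "range y"]) auto
qed

text \<open>A closure of Loewenheim-Skolem type: for every finite \<open>X\<close> inside the set
  built so far and every two of its vertices in \<open>f X\<close>, a finite linking set within
  \<open>f X\<close> is added. Linkage is asked only for \<open>X \<subseteq> H\<close>, since a
  countable set has only countably many finite subsets.\<close>

lemma exists_countable_linked_hitting_set:
  "\<exists>H. countable H \<and> H \<subseteq> V \<and> (\<forall>X\<in>fin_subsets V. f X \<inter> H \<noteq> {}) \<and>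
     (\<forall>X\<in>fin_subsets V. X \<subseteq> H \<longrightarrow>
        (\<forall>u\<in>f X \<inter> H. \<forall>w\<in>f X \<inter> H. strongly_linked E (f X \<inter> H) u w))"
proof -
  obtain U where U: "countable U" "U \<subseteq> V" "\<And>X. X \<in> fin_subsets V \<Longrightarrow> f X \<inter> U \<noteq> {}"
    using exists_countable_hitting_set by blast
  have "\<exists>W. finite W \<and> W \<subseteq> f X \<and> strongly_linked E W u w"
    if "X \<in> fin_subsets V" "u \<in> f X" "w \<in> f X" for X u w
    using strongly_linked_finite_support scomps_strongly_linked[OF scomps[OF that(1)] that(2,3)]
    by metis
  then obtain W where W: "\<And>X u w. X \<in> fin_subsets V \<Longrightarrow> u \<in> f X \<Longrightarrow> w \<in> f X \<Longrightarrow>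
      finite (W X u w) \<and> W X u w \<subseteq> f X \<and> strongly_linked E (W X u w) u w" by metis
  define g where "g A = (\<Union>X\<in>{X. X \<subseteq> A \<and> finite X}. \<Union>u\<in>f X \<inter> A. \<Union>w\<in>f X \<inter> A. W X u w)" for A
  define A where "A = accumulate g U"
  have A: "countable (A n) \<and> A n \<subseteq> V" for n
  proof (induction n)
    case 0
    then show ?case using U by (simp add: A_def)
  next
    case (Suc n)
    then have cn: "countable (A n)" "A n \<subseteq> V" by auto
    have fs: "X \<in> fin_subsets V" if "X \<subseteq> A n" "finite X" for X
      using that cn by (auto simp: fin_subsets_def)
    have "{X. X \<subseteq> A n \<and> finite X} = {X. finite X \<and> X \<subseteq> A n}" by auto
    then have c: "countable {X. X \<subseteq> A n \<and> finite X}"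
      using countable_Collect_finite_subset[OF cn(1)] by simp
    have "countable (g (A n))"
      unfolding g_def
    proof (intro countable_UN c)
      fix X u w
      assume "X \<in> {X. X \<subseteq> A n \<and> finite X}" "u \<in> f X \<inter> A n" "w \<in> f X \<inter> A n"
      then show "countable (W X u w)" using W[of X u w] fs by (auto intro: countable_finite)
    qed (use cn in auto)
    moreover have "g (A n) \<subseteq> V"
      unfolding g_def using W fs subset by blast
    ultimately show ?case using cn by (simp add: A_def)
  qed
  have mono: "A m \<subseteq> A n" if "m \<le> n" for m n
    using accumulate_mono[OF that] by (simp add: A_def)
  define H where "H = (\<Union>n. A n)"
  have "U \<subseteq> H" unfolding H_def A_def by (metis UN_upper UNIV_I accumulate.simps(1))
  have "strongly_linked E (f X \<inter> H) u w"
    if X: "X \<in> fin_subsets V" "X \<subseteq> H" and uw: "u \<in> f X \<inter> H" "w \<in> f X \<inter> H" for X u w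
  proof -
    \<comment> \<open>The stages increase, so \<open>X\<close>, \<open>u\<close> and
      \<open>w\<close> all occur at one stage, and the next stage adds their linking set.\<close>
    have "\<exists>n. S \<subseteq> A n" if "finite S" "S \<subseteq> H" for S
      using that
    proof (induction S)
      case (insert x S)
      then obtain m n where "S \<subseteq> A m" "x \<in> A n" by (auto simp: H_def)
      then have "insert x S \<subseteq> A (max m n)"
        using mono[of m "max m n"] mono[of n "max m n"] by auto
      then show ?case by blast
    qed simp
    from this[of "insert u (insert w X)"] obtain n where n: "insert u (insert w X) \<subseteq> A n"
      using X uw by (auto simp: fin_subsets_def)
    have "W X u w \<subseteq> g (A n)" unfolding g_def using n X uw by (auto simp: fin_subsets_def)
    also have "\<dots> \<subseteq> H" unfolding H_def A_def by (rule UN_upper[THEN order_trans[rotated], of "Suc n"]) auto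
    finally have "W X u w \<subseteq> f X \<inter> H" using W[of X u w] X uw by auto
    moreover have "strongly_linked E (W X u w) u w" using W[of X u w] X uw by simp
    ultimately show ?thesis using strongly_linked_mono by metis
  qed
  moreover have "countable H" "H \<subseteq> V" using A by (auto simp: H_def)
  moreover have "f X \<inter> H \<noteq> {}" if "X \<in> fin_subsets V" for X
    using U(3)[OF that] \<open>U \<subseteq> H\<close> by blast
  ultimately show ?thesis by (intro exI[of _ H] conjI ballI impI) simp_all
qed

end

section \<open>A ray through a decreasing sequence of strongly connected sets\<close>

lemma exists_progressing_ray:
  fixes g :: "nat \<Rightarrow> 'v set" and R :: "('v \<times> 'v) set"
  assumes dec: "decseq g" and ne: "\<And>n. g n \<noteq> {}" and cap: "(\<Inter>n. g n) = {}"
    and linked: "\<And>n u w. u \<in> g n \<Longrightarrow> w \<in> g n \<Longrightarrow> (u, w) \<in> (R \<inter> g n \<times> g n)\<^sup>*"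
  shows "\<exists>r. inj r \<and> (\<forall>i. r i \<in> g 0 \<and> (r i, r (Suc i)) \<in> R) \<and> (\<forall>n. tail_in r (g n))"
\<comment> \<open>From each vertex there is an edge that either increases the rank, or keeps it and decreases the
  distance to the next level; following such edges never repeats a vertex.\<close>
proof -
  \<comment> \<open>Every vertex drops out of the decreasing sets \<open>g n\<close> at some point,
    so the least index exists. A vertex lies in exactly the levels below its rank; in particular,
    vertices of \<open>g 0\<close> have positive rank.\<close>
  define rank where "rank u = (LEAST n. u \<notin> g n)" for u
  have notin: "u \<notin> g (rank u)" for u
    unfolding rank_def by (rule LeastI_ex) (use cap in blast)
  have rank: "u \<in> g n \<longleftrightarrow> n < rank u" for u n
  proof
    assume u: "u \<in> g n"
    show "n < rank u"
    proof (rule ccontr)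
      assume "\<not> n < rank u"
      then have "g n \<subseteq> g (rank u)" using decseqD[OF dec] by simp
      then show False using u notin[of u] by blast
    qed
  next
    assume "n < rank u"
    then show "u \<in> g n" unfolding rank_def using not_less_Least[of n "\<lambda>n. u \<notin> g n"] by blast
  qed
  define R' where "R' n = R \<inter> g n \<times> g n" for n
  define climbs where "climbs n k u \<longleftrightarrow> (\<exists>w\<in>g (Suc n). (u, w) \<in> R' n ^^ k)" for n k u
  \<comment> \<open>The last level containing \<open>u\<close> is \<open>rank u - 1\<close>;
    \<open>d u\<close> is the distance from \<open>u\<close> to the next level, measured inside that
    last level.\<close>
  define d where "d u = (LEAST k. climbs (rank u - 1) k u)" for u
  define prog where
    "prog u u' \<longleftrightarrow> rank u < rank u' \<or> rank u = rank u' \<and> d u' < d u" for u u'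
  have "\<exists>u'. u' \<in> g 0 \<and> (u, u') \<in> R \<and> prog u u'" if u: "u \<in> g 0" for u
  proof -
    define n where "n = rank u - 1"
    have n: "rank u = Suc n" using u rank[of u 0] by (simp add: n_def)
    then have un: "u \<in> g n" "u \<notin> g (Suc n)" using rank by auto
    obtain w where w: "w \<in> g (Suc n)" using ne by blast
    then have "w \<in> g n" using decseqD[OF dec, of n "Suc n"] by auto
    then have "\<exists>k. climbs n k u"
      using linked[OF un(1)] w unfolding climbs_def R'_def rtrancl_power by blast
    then have "climbs n (d u) u" unfolding d_def n_def by (rule LeastI_ex)
    then obtain w where w: "w \<in> g (Suc n)" "(u, w) \<in> R' n ^^ d u"
      unfolding climbs_def by blast
    \<comment> \<open>\<open>d u\<close> is not 0, because \<open>u\<close> itself lies outside the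
      next level; so a shortest walk has a first edge.\<close>
    then obtain k where k: "d u = Suc k" using un(2) by (cases "d u") auto
    with w(2) obtain u' where u': "(u, u') \<in> R' n" "(u', w) \<in> R' n ^^ k"
      using relpow_Suc_D2[of u w k "R' n"] by auto
    have "u' \<in> g n" using u'(1) by (simp add: R'_def)
    then have ge: "rank u \<le> rank u'" using rank n by (simp add: Suc_le_eq)
    have "prog u u'"
    proof (cases "rank u < rank u'")
      case False
      then have eq: "rank u' = Suc n" using ge n by simp
      \<comment> \<open>The rest of the shortest walk still ends in the next level, so its length
        bounds \<open>d u'\<close>.\<close>
      have "climbs n k u'" unfolding climbs_def using u'(2) w(1) by blast
      then have "d u' \<le> k" unfolding d_def eq by (auto intro: Least_le)
      then show ?thesis using eq n k by (simp add: prog_def)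
    qed (simp add: prog_def)
    moreover have "u' \<in> g 0" using \<open>u' \<in> g n\<close> rank by auto
    ultimately show ?thesis using u'(1) by (auto simp: R'_def)
  qed
  then obtain r where r: "\<And>i. r i \<in> g 0" "\<And>i. (r i, r (Suc i)) \<in> R \<and> prog (r i) (r (Suc i))"
    using dependent_nat_choice[of "\<lambda>_ u. u \<in> g 0" "\<lambda>_ u u'. (u, u') \<in> R \<and> prog u u'"] ne[of 0]
    by (metis ex_in_conv)
  have prog: "prog (r i) (r j)" if "i < j" for i j
    using that
  proof (induction j)
    case (Suc j)
    then show ?case using r(2)[of j] by (cases "i = j") (auto simp: prog_def)
  qed simp
  have "inj r"
  proof (rule injI)
    fix i j
    assume eq: "r i = r j"
    have "\<not> i < j" "\<not> j < i" using prog[of i j] prog[of j i] eq by (auto simp: prog_def)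
    then show "i = j" by simp
  qed
  \<comment> \<open>The rank cannot stall, since then \<open>d\<close> would decrease
    forever.\<close>
  have climb: "\<exists>j. rank (r i) < rank (r j)" for i
  proof (induction "d (r i)" arbitrary: i rule: less_induct)
    case less
    then show ?case using r(2)[of i] unfolding prog_def by metis
  qed
  have "\<exists>k. n < rank (r k)" for n
  proof (induction n)
    case 0
    then show ?case using r(1) rank by blast
  next
    case (Suc n)
    then show ?case using climb by (meson Suc_lessI less_trans_Suc)
  qed
  moreover have "rank (r k) \<le> rank (r i)" if "k \<le> i" for k i
    using that prog[of k i] by (cases "k = i") (auto simp: prog_def)
  ultimately have "tail_in r (g n)" for n
    unfolding tail_in_def rank by (meson less_le_trans)
  with \<open>inj r\<close> r show ?thesis by blast
qed

context direction
begin

lemma exists_ray: "\<exists>r. is_ray V E r \<and> (\<forall>X\<in>fin_subsets V. tail_in r (f X))"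
proof -
  obtain H where H: "countable H" "H \<subseteq> V" "\<And>X. X \<in> fin_subsets V \<Longrightarrow> f X \<inter> H \<noteq> {}"
    and linked: "\<And>X u w. X \<in> fin_subsets V \<Longrightarrow> X \<subseteq> H \<Longrightarrow> u \<in> f X \<inter> H \<Longrightarrow> w \<in> f X \<inter> H \<Longrightarrow>
      strongly_linked E (f X \<inter> H) u w"
    using exists_countable_linked_hitting_set by (elim exE conjE) simp
  have "{} \<in> fin_subsets V" by (simp add: fin_subsets_def)
  then have "H \<noteq> {}" using H(3) by blast
  then have range: "range (from_nat_into H) = H" using H(1) by simp
  \<comment> \<open>Initial segments of an enumeration of \<open>H\<close>, possibly with
    repetitions: finite sets that exhaust \<open>H\<close>.\<close>
  define Y where "Y n = from_nat_into H ` {..<n}" for n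
  have YH: "Y n \<subseteq> H" for n using range by (auto simp: Y_def)
  then have Y: "Y n \<in> fin_subsets V" for n
    using H(2) by (auto simp: fin_subsets_def Y_def)
  define g where "g n = f (Y n) \<inter> H" for n
  have "decseq g"
  proof (rule decseq_SucI)
    have "f (Y (Suc n)) \<subseteq> f (Y n)" for n
      by (rule antimono) (use Y in \<open>auto simp: Y_def\<close>)
    then show "g (Suc n) \<subseteq> g n" for n by (auto simp: g_def)
  qed
  moreover have "(\<Inter>n. g n) = {}"
  proof -
    have "h \<notin> (\<Inter>n. g n)" if "h \<in> H" for h
    proof -
      obtain k where "h = from_nat_into H k" using range \<open>h \<in> H\<close> by blast
      then have "h \<in> Y (Suc k)" by (auto simp: Y_def)
      then have "h \<notin> g (Suc k)" using subset[OF Y[of "Suc k"]] by (auto simp: g_def)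
      then show ?thesis by blast
    qed
    then show ?thesis by (auto simp: g_def)
  qed
  ultimately obtain r where r: "inj r" "\<And>i. r i \<in> g 0" "\<And>i. (r i, r (Suc i)) \<in> E"
    "\<And>n. tail_in r (g n)"
    using exists_progressing_ray[of g E] H(3)[OF Y] linked[OF Y YH]
    unfolding g_def strongly_linked_def by blast
  have "tail_in r (f X)" if X: "X \<in> fin_subsets V" for X
  proof -
    \<comment> \<open>Only the part of \<open>X\<close> inside \<open>H\<close> is covered by some
      \<open>Y n\<close>. This suffices: \<open>f X' \<inter> H\<close> avoids all of
      \<open>X\<close>, is strongly linked, and contains a vertex of \<open>f X\<close>.\<close>
    define X' where "X' = X \<inter> H"
    have X': "X' \<in> fin_subsets V" "X' \<subseteq> H" "X' \<subseteq> X" using X by (auto simp: X'_def fin_subsets_def)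
    have "\<exists>n. X' \<subseteq> Y n"
    proof -
      have "finite X'" "X' \<subseteq> from_nat_into H ` UNIV"
        using X' range by (auto simp: fin_subsets_def)
      then obtain N where N: "finite N" "X' = from_nat_into H ` N" by (metis finite_subset_image)
      then obtain n where "N \<subseteq> {..<n}" using finite_nat_iff_bounded by blast
      then show ?thesis using N by (auto simp: Y_def)
    qed
    then obtain n where n: "X' \<subseteq> Y n" by blast
    obtain u where u: "u \<in> f X" "u \<in> H" using H(3)[OF X] by blast
    then have u': "u \<in> f X' \<inter> H" using antimono[OF X'(1) X X'(3)] by blast
    have sub: "f X' \<inter> H \<subseteq> V - X" using subset[OF X'(1)] H(2) by (auto simp: X'_def)
    have "w \<in> f X" if "w \<in> f X' \<inter> H" for w
      using strongly_linked_scomps[OF linked[OF X'(1,2) u' that] sub scomps[OF X] u(1)] .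
    moreover have "g n \<subseteq> f X' \<inter> H" using antimono[OF X'(1) Y n] by (auto simp: g_def)
    ultimately have "g n \<subseteq> f X" by blast
    then show ?thesis using r(4)[of n] unfolding tail_in_def by blast
  qed
  moreover have "is_ray V E r"
    using r(1,2,3) H(2) unfolding is_ray_def g_def by blast
  ultimately show ?thesis by blast
qed

lemma exists_end: "\<exists>\<omega>\<in>ends V E. \<forall>X\<in>fin_subsets V. end_comp V E X \<omega> = f X"
proof -
  obtain r where r: "is_ray V E r" "\<And>X. X \<in> fin_subsets V \<Longrightarrow> tail_in r (f X)"
    using exists_ray by blast
  then have "solid_ray V E r" unfolding solid_ray_def using scomps by blast
  then show ?thesis
    using end_comp_eqI[OF _ _ scomps r(2)] unfolding ends_def by blast
qed

end

section \<open>Ultrafilters\<close>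

definition ultra :: "'a filter \<Rightarrow> bool" where
  "ultra F \<longleftrightarrow> F \<noteq> bot \<and> (\<forall>P. eventually P F \<or> eventually (\<lambda>x. \<not> P x) F)"

lemma exists_ultra:
  fixes F :: "'a filter"
  assumes "F \<noteq> bot"
  shows "\<exists>U\<le>F. ultra U"
proof -
  define A where "A = {G. G \<noteq> bot \<and> G \<le> F}"
  have "\<exists>m\<in>A. \<forall>a\<in>A. a \<le> m \<longrightarrow> a = m"
  proof (rule predicate_Zorn)
    show "partial_order_on A (relation_of (\<lambda>x y. y \<le> x) A)"
      by (rule partial_order_on_relation_ofI) auto
    fix C
    assume C: "C \<in> Chains (relation_of (\<lambda>x y. y \<le> x) A)"
    show "\<exists>u\<in>A. \<forall>a\<in>C. u \<le> a"
    proof (cases "C = {}")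
      case True
      then show ?thesis using assms by (auto simp: A_def)
    next
      case False
      have CA: "C \<subseteq> A" using C unfolding Chains_def relation_of_def by auto
      \<comment> \<open>A chain is directed downwards, so what is eventual for \<open>Inf C\<close>
        is already eventual for a member; hence the infimum is again proper.\<close>
      have "\<exists>x\<in>C. x \<le> inf G H" if "G \<in> C" "H \<in> C" for G H
        using C that unfolding Chains_def relation_of_def by fastforce
      then have "eventually P (Inf C) \<longleftrightarrow> (\<exists>b\<in>C. eventually P b)" for P
        using eventually_Inf_base[OF False] by blast
      then have "Inf C \<noteq> bot"
        using CA unfolding A_def trivial_limit_def by blast
      moreover obtain c where "c \<in> C" using False by blast
      ultimately have "Inf C \<in> A"
        using CA Inf_lower[of c C] unfolding A_def by (auto intro: order_trans)
      then show ?thesis by (auto intro: Inf_lower)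
    qed
  qed
  then obtain m where m: "m \<noteq> bot" "m \<le> F" "\<And>a. a \<noteq> bot \<Longrightarrow> a \<le> F \<Longrightarrow> a \<le> m \<Longrightarrow> a = m"
    unfolding A_def by blast
  have "eventually P m \<or> eventually (\<lambda>x. \<not> P x) m" for P
  proof (rule disjCI)
    assume *: "\<not> eventually (\<lambda>x. \<not> P x) m"
    \<comment> \<open>Adding \<open>P\<close> keeps the filter proper, as the negation of
      \<open>P\<close> is not eventual; minimality of \<open>m\<close> then forces
      \<open>?G = m\<close>.\<close>
    let ?G = "inf m (principal {x. P x})"
    have "?G \<noteq> bot"
      using * by (simp add: trivial_limit_def eventually_inf_principal)
    then have "?G = m" using m(2) m(3)[of ?G] by (auto intro: le_infI1)
    moreover have "eventually P ?G" by (simp add: eventually_inf_principal)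
    ultimately show "eventually P m" by simp
  qed
  with m show ?thesis by (auto simp: ultra_def)
qed

lemma ultra_not_bot: "ultra F \<Longrightarrow> F \<noteq> bot"
  by (simp add: ultra_def)

lemma ultra_ex:
  assumes "ultra F" "eventually P F"
  shows "\<exists>x. P x"
  using eventually_happens[OF assms(2)] ultra_not_bot[OF assms(1)] by blast

lemma ultra_finite_Bex:
  assumes "ultra F" "finite I" "eventually (\<lambda>x. \<exists>i\<in>I. P i x) F"
  shows "\<exists>i\<in>I. eventually (P i) F"
proof (rule ccontr)
  assume "\<not> ?thesis"
  then have "\<forall>i\<in>I. eventually (\<lambda>x. \<not> P i x) F" using assms(1) by (auto simp: ultra_def)
  then have "eventually (\<lambda>x. \<forall>i\<in>I. \<not> P i x) F"
    using assms(2) by (simp add: eventually_ball_finite)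
  with assms(3) have "eventually (\<lambda>x. False) F"
    by (rule eventually_elim2) auto
  then show False using ultra_ex[OF assms(1)] by blast
qed

text \<open>A cluster point of an ultrafilter is already a limit: if a neighbourhood were not
  eventually entered, its complement would be, contrary to clustering.\<close>

lemma ultra_tendsto_compact:
  fixes t :: "'a \<Rightarrow> 'b :: topological_space"
  assumes "ultra F" "compact K" "eventually (\<lambda>x. t x \<in> K) F"
  shows "\<exists>l\<in>K. (t \<longlongrightarrow> l) F"
proof -
  have "filtermap t F \<noteq> bot" "eventually (\<lambda>x. x \<in> K) (filtermap t F)"
    using assms by (auto simp: ultra_def filtermap_bot_iff eventually_filtermap)
  then obtain l where l: "l \<in> K" "inf (nhds l) (filtermap t F) \<noteq> bot"
    using assms(2) unfolding compact_filter by blast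
  have "eventually (\<lambda>x. t x \<in> S) F" if S: "open S" "l \<in> S" for S
  proof (rule ccontr)
    assume "\<not> ?thesis"
    then have "eventually (\<lambda>x. t x \<notin> S) F" using assms(1) by (auto simp: ultra_def)
    then have "eventually (\<lambda>y. y \<notin> S) (inf (nhds l) (filtermap t F))"
      by (intro filter_leD[OF inf_le2]) (simp add: eventually_filtermap)
    moreover have "eventually (\<lambda>y. y \<in> S) (inf (nhds l) (filtermap t F))"
      using S by (intro filter_leD[OF inf_le1]) (simp add: eventually_nhds_in_open)
    ultimately have "eventually (\<lambda>y. False) (inf (nhds l) (filtermap t F))"
      by (rule eventually_elim2) auto
    with l(2) show False by (simp add: trivial_limit_def)
  qed
  with l(1) show ?thesis by (auto intro: topological_tendstoI)
qed

text \<open>Without a finite subcover, the complements of finite unions of cover members generate a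
  proper filter. A finer ultrafilter eventually leaves every member, so it cannot converge to a
  covered point.\<close>

lemma compact_space_if_ultra_converge:
  assumes conv: "\<And>F. ultra F \<Longrightarrow> eventually (\<lambda>x. x \<in> topspace T) F \<Longrightarrow>
    \<exists>l\<in>topspace T. \<forall>W. openin T W \<longrightarrow> l \<in> W \<longrightarrow> eventually (\<lambda>x. x \<in> W) F"
  shows "compact_space T"
  unfolding compact_space_alt
proof (intro allI impI)
  fix \<U>
  assume \<U>: "(\<forall>U\<in>\<U>. openin T U) \<and> topspace T \<subseteq> \<Union>\<U>"
  show "\<exists>\<F>. finite \<F> \<and> \<F> \<subseteq> \<U> \<and> topspace T \<subseteq> \<Union>\<F>"
  proof (rule ccontr)
    assume none: "\<not> ?thesis"
    define F where "F = (INF \<F>\<in>{\<F>. finite \<F> \<and> \<F> \<subseteq> \<U>}. principal (topspace T - \<Union>\<F>))"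
    have "\<exists>\<H>\<in>{\<F>. finite \<F> \<and> \<F> \<subseteq> \<U>}. principal (topspace T - \<Union>\<H>)
        \<le> inf (principal (topspace T - \<Union>\<F>)) (principal (topspace T - \<Union>\<G>))"
      if "\<F> \<in> {\<F>. finite \<F> \<and> \<F> \<subseteq> \<U>}" "\<G> \<in> {\<F>. finite \<F> \<and> \<F> \<subseteq> \<U>}" for \<F> \<G>
      using that by (intro bexI[of _ "\<F> \<union> \<G>"]) auto
    then have F: "eventually P F \<longleftrightarrow>
        (\<exists>\<F>\<in>{\<F>. finite \<F> \<and> \<F> \<subseteq> \<U>}. eventually P (principal (topspace T - \<Union>\<F>)))" for P
      unfolding F_def by (intro eventually_INF_base) auto
    have "F \<noteq> bot"
      unfolding trivial_limit_def F eventually_principal using none by blast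
    then obtain G where G: "G \<le> F" "ultra G" using exists_ultra by blast
    have ev: "eventually (\<lambda>x. x \<in> topspace T - \<Union>\<F>) G" if "finite \<F>" "\<F> \<subseteq> \<U>" for \<F>
      by (rule filter_leD[OF G(1)]) (use that in \<open>auto simp: F eventually_principal\<close>)
    have "eventually (\<lambda>x. x \<in> topspace T) G" using ev[of "{}"] by simp
    then obtain l where l: "l \<in> topspace T"
      "\<And>W. openin T W \<Longrightarrow> l \<in> W \<Longrightarrow> eventually (\<lambda>x. x \<in> W) G"
      using conv[OF G(2)] by blast
    then obtain U where U: "U \<in> \<U>" "l \<in> U" using \<U> by blast
    then have "eventually (\<lambda>x. x \<in> U) G" using l(2) \<U> by blast
    moreover have "eventually (\<lambda>x. x \<in> topspace T - \<Union>{U}) G" using U by (intro ev) auto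
    ultimately have "eventually (\<lambda>x. False) G" by (rule eventually_elim2) auto
    then show False using ultra_ex[OF G(2)] by blast
  qed
qed

text \<open>Convergence may be tested on a subbasis, because eventual membership is preserved by
  finite intersections and by enlarging the set.\<close>

lemma eventually_in_open_generated:
  assumes "\<And>B. B \<in> S \<Longrightarrow> x \<in> B \<Longrightarrow> eventually (\<lambda>y. y \<in> B) F"
    and "openin (topology_generated_by S) W" "x \<in> W"
  shows "eventually (\<lambda>y. y \<in> W) F"
proof -
  have "generate_topology_on S W" using assms(2) by (simp add: openin_topology_generated_by_iff)
  then show ?thesis using assms(3)
  proof (induction rule: generate_topology_on.induct)
    case (Int a b)
    then show ?case by (simp add: eventually_conj)
  next
    case (UN K)
    then obtain k where "k \<in> K" "eventually (\<lambda>y. y \<in> k) F" by blast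
    then show ?case by (auto elim: eventually_mono)
  qed (use assms(1) in auto)
qed

section \<open>Limits of nodes\<close>

lemma node_in_unique:
  "node_in V E X C n \<Longrightarrow> node_in V E X D n \<Longrightarrow> C \<in> scomps V E X \<Longrightarrow> D \<in> scomps V E X \<Longrightarrow> C = D"
  by (cases n) (auto simp: node_in_def dest: scomps_disjoint)

text \<open>The two kinds of condition by which basic open sets refer to a tail or a head. Since
  equality with a vertex is one of them, nodes that converge to a vertex are eventually equal to
  it.\<close>

definition node_pred :: "'v set \<Rightarrow> ('v \<times> 'v) set \<Rightarrow> ('v node \<Rightarrow> bool) \<Rightarrow> bool" where
  "node_pred V E P \<longleftrightarrow> (\<exists>v. P = (\<lambda>n. n = NV v)) \<or>
     (\<exists>X\<in>fin_subsets V. \<exists>C\<in>scomps V E X. P = node_in V E X C)"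

definition node_limit ::
  "'v set \<Rightarrow> ('v \<times> 'v) set \<Rightarrow> 'a filter \<Rightarrow> ('a \<Rightarrow> 'v node) \<Rightarrow> 'v node \<Rightarrow> bool" where
  "node_limit V E F n a \<longleftrightarrow> (\<forall>P. node_pred V E P \<longrightarrow> P a \<longrightarrow> eventually (\<lambda>x. P (n x)) F)"

lemma node_limit_eq: "node_limit V E F n a \<Longrightarrow> a = NV v \<Longrightarrow> eventually (\<lambda>x. n x = NV v) F"
  unfolding node_limit_def node_pred_def by blast

lemma node_limit_in:
  "node_limit V E F n a \<Longrightarrow> X \<in> fin_subsets V \<Longrightarrow> C \<in> scomps V E X \<Longrightarrow> node_in V E X C a \<Longrightarrow>
   eventually (\<lambda>x. node_in V E X C (n x)) F"
  unfolding node_limit_def node_pred_def by blast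

lemma node_in_end_comp:
  "\<omega> \<in> ends V E \<Longrightarrow> node_in V E X (end_comp V E X \<omega>) (NE \<omega>)"
  by (simp add: node_in_def)

text \<open>An end outside \<open>C\<close> lives in a different component, which shares no nodes
  with \<open>C\<close>. Negative information is required for \<open>chat\<close>, where a half-open
  segment depends on an endpoint lying outside.\<close>

lemma node_limit_not_in:
  assumes lim: "node_limit V E F n a" and a: "a \<in> nodes V E"
    and X: "X \<in> fin_subsets V" and C: "C \<in> scomps V E X" and notin: "\<not> node_in V E X C a"
  shows "eventually (\<lambda>x. \<not> node_in V E X C (n x)) F"
proof (cases a)
  case (NV v)
  then show ?thesis
    using node_limit_eq[OF lim] notin by (auto elim: eventually_mono)
next
  case (NE \<omega>)
  then have \<omega>: "\<omega> \<in> ends V E" using a by (auto simp: nodes_def)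
  let ?D = "end_comp V E X \<omega>"
  have D: "?D \<in> scomps V E X" using end_comp_scomps[OF \<omega> X] .
  have "?D \<noteq> C" using notin NE node_in_end_comp[OF \<omega>] by metis
  have "eventually (\<lambda>x. node_in V E X ?D (n x)) F"
    using node_limit_in[OF lim X D] NE node_in_end_comp[OF \<omega>] by metis
  then show ?thesis
    by (rule eventually_mono) (use node_in_unique[OF _ _ D C] \<open>?D \<noteq> C\<close> in blast)
qed

lemma exists_node_limit:
  assumes solid: "solid V E" and F: "ultra F" and ev: "eventually (\<lambda>x. n x \<in> nodes V E) F"
  shows "\<exists>a\<in>nodes V E. node_limit V E F n a"
proof (cases "\<exists>v. eventually (\<lambda>x. n x = NV v) F")
  case True
  then obtain v where v: "eventually (\<lambda>x. n x = NV v) F" by blast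
  then have "NV v \<in> nodes V E" using ultra_ex[OF F eventually_conj[OF v ev]] by auto
  moreover have "node_limit V E F n (NV v)"
    unfolding node_limit_def using v by (auto elim: eventually_mono)
  ultimately show ?thesis by blast
next
  case False
  have "\<exists>C\<in>scomps V E X. eventually (\<lambda>x. node_in V E X C (n x)) F" if X: "X \<in> fin_subsets V" for X
  proof (rule ultra_finite_Bex[OF F])
    show "finite (scomps V E X)" using solid X by (simp add: solid_def)
    \<comment> \<open>Being eventually at no single vertex, the nodes eventually avoid the finite
      set \<open>X\<close>; each of them then lies or lives in one of the finitely many
      components.\<close>
    have "\<forall>v\<in>X. eventually (\<lambda>x. n x \<noteq> NV v) F" using False F by (auto simp: ultra_def)
    then have "eventually (\<lambda>x. \<forall>v\<in>X. n x \<noteq> NV v) F"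
      using X by (intro eventually_ball_finite) (auto simp: fin_subsets_def)
    with ev show "eventually (\<lambda>x. \<exists>C\<in>scomps V E X. node_in V E X C (n x)) F"
    proof (rule eventually_elim2)
      fix x
      assume x: "n x \<in> nodes V E" "\<forall>v\<in>X. n x \<noteq> NV v"
      show "\<exists>C\<in>scomps V E X. node_in V E X C (n x)"
      proof (cases "n x")
        case (NV u)
        then show ?thesis using x scomps_cover[of u V X E] by (auto simp: nodes_def node_in_def)
      next
        case (NE \<omega>)
        then show ?thesis
          using x end_comp_scomps[OF _ X] by (auto simp: nodes_def node_in_def)
      qed
    qed
  qed
  then obtain f where f: "\<And>X. X \<in> fin_subsets V \<Longrightarrow>
      f X \<in> scomps V E X \<and> eventually (\<lambda>x. node_in V E X (f X) (n x)) F" by metis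
  interpret direction V E f
  proof
    show "f X \<in> scomps V E X" if "X \<in> fin_subsets V" for X using f[OF that] by blast
    show "f Y \<subseteq> f X" if XY: "X \<in> fin_subsets V" "Y \<in> fin_subsets V" "X \<subseteq> Y" for X Y
    proof -
      \<comment> \<open>Two eventual properties hold together somewhere: one node belongs to both
        selected components, which makes them nested.\<close>
      obtain x where x: "node_in V E X (f X) (n x)" "node_in V E Y (f Y) (n x)"
        using ultra_ex[OF F eventually_conj] f[OF XY(1)] f[OF XY(2)] by blast
      show ?thesis
      proof (cases "n x")
        case (NV u)
        then show ?thesis
          using x scomps_antimono[OF XY(3) conjunct1[OF f[OF XY(1)]] conjunct1[OF f[OF XY(2)]]]
          by (simp add: node_in_def)
      next
        case (NE \<omega>)
        then have "\<omega> \<in> ends V E" "end_comp V E X \<omega> = f X" "end_comp V E Y \<omega> = f Y"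
          using x by (simp_all add: node_in_def)
        then show ?thesis using end_comp_antimono[OF _ XY] by metis
      qed
    qed
  qed
  obtain \<omega> where \<omega>: "\<omega> \<in> ends V E" "\<And>X. X \<in> fin_subsets V \<Longrightarrow> end_comp V E X \<omega> = f X"
    using exists_end by blast
  have "node_limit V E F n (NE \<omega>)"
    unfolding node_limit_def node_pred_def using \<omega> f by (auto simp: node_in_def)
  then show ?thesis using \<omega>(1) by (auto simp: nodes_def)
qed

section \<open>The space\<close>

lemma mem_limit_edges:
  "(NV u, NV w) \<notin> limit_edges V E"
  "(NE \<omega>, NE \<eta>) \<in> limit_edges V E \<longleftrightarrow> \<omega> \<in> ends V E \<and> \<eta> \<in> ends V E \<and> \<omega> \<noteq> \<eta> \<and>
     (\<forall>X \<in> fin_subsets V. end_comp V E X \<omega> \<noteq> end_comp V E X \<eta> \<longrightarrow>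
       (\<exists>u w. (u, w) \<in> E \<and> u \<in> end_comp V E X \<omega> \<and> w \<in> end_comp V E X \<eta>))"
  "(NV v, NE \<omega>) \<in> limit_edges V E \<longleftrightarrow> v \<in> V \<and> \<omega> \<in> ends V E \<and>
     (\<forall>X \<in> fin_subsets V. v \<notin> end_comp V E X \<omega> \<longrightarrow>
       (\<exists>w. (v, w) \<in> E \<and> w \<in> end_comp V E X \<omega>))"
  "(NE \<omega>, NV v) \<in> limit_edges V E \<longleftrightarrow> v \<in> V \<and> \<omega> \<in> ends V E \<and>
     (\<forall>X \<in> fin_subsets V. v \<notin> end_comp V E X \<omega> \<longrightarrow>
       (\<exists>u. (u, v) \<in> E \<and> u \<in> end_comp V E X \<omega>))"
  unfolding limit_edges_def by simp_all

lemma mem_all_edges: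
  "(NV u, NV w) \<in> all_edges V E \<longleftrightarrow> (u, w) \<in> E"
  "(NE \<omega>, n) \<in> all_edges V E \<longleftrightarrow> (NE \<omega>, n) \<in> limit_edges V E"
  "(n, NE \<omega>) \<in> all_edges V E \<longleftrightarrow> (n, NE \<omega>) \<in> limit_edges V E"
  unfolding all_edges_def by (simp_all add: mem_limit_edges)

text \<open>The three families around inner points of limit edges become one case, because each
  constrains tail and head by a \<open>node_pred\<close>. Convergence to inner points then gets a
  single argument for them.\<close>

lemma dtop_basis_cases:
  assumes "B \<in> dtop_basis V E"
  obtains (star) v \<epsilon> where "B = star V E v \<epsilon>" "v \<in> V" "0 < \<epsilon>" "\<epsilon> < 1"
  | (interval) u w a b where "B = {PI (NV u, NV w) t | t. a < t \<and> t < b}"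
      "(NV u, NV w) \<in> all_edges V E" "0 \<le> a" "b \<le> 1"
  | (chat) \<epsilon> X \<omega> where "B = chat V E \<epsilon> X \<omega>" "\<omega> \<in> ends V E" "X \<in> fin_subsets V" "0 < \<epsilon>" "\<epsilon> < 1"
  | (edges) P Q \<epsilon> z where "B = edge_nbhd V E (\<lambda>e. P (fst e) \<and> Q (snd e)) \<epsilon> z"
      "node_pred V E P" "node_pred V E Q" "\<epsilon> \<le> min z (1 - z)"
proof -
  have ec: "node_pred V E (node_in V E X (end_comp V E X \<omega>))"
    if "X \<in> fin_subsets V" "\<omega> \<in> ends V E" for X \<omega>
    using that end_comp_scomps unfolding node_pred_def by blast
  have nv: "node_pred V E (\<lambda>n. n = NV v)" for v
    unfolding node_pred_def by blast
  have le: "(NE \<omega>, n) \<in> limit_edges V E \<Longrightarrow> \<omega> \<in> ends V E"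
    "(n, NE \<omega>) \<in> limit_edges V E \<Longrightarrow> \<omega> \<in> ends V E" for n \<omega>
    by (auto simp: limit_edges_def)
  from assms show thesis
    unfolding dtop_basis_def
  proof (elim UnE CollectE exE conjE, goal_cases)
    case (1 v \<epsilon>)
    then show ?case using star by blast
  next
    case (2 e a b)
    then obtain u w where "e = (NV u, NV w)" by (metis imageE prod.collapse)
    with 2 show ?case using interval by blast
  next
    case (3 \<epsilon> X \<omega>)
    then show ?case using chat by blast
  next
    case (4 \<omega> \<eta> X \<epsilon> z)
    then show ?case using edges[OF _ ec ec] le by blast
  next
    case (5 v \<omega> X \<epsilon> z)
    then show ?case using edges[OF _ nv ec] le by blast
  next
    case (6 v \<omega> X \<epsilon> z)
    then show ?case using edges[OF _ ec nv] le by blast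
  qed
qed

lemma mem_star_PI:
  "PI e t \<in> star V E v \<epsilon> \<longleftrightarrow> e \<in> all_edges V E \<and>
     (fst e = NV v \<and> 0 < t \<and> t < \<epsilon> \<or> snd e = NV v \<and> 1 - \<epsilon> < t \<and> t < 1)"
  by (cases e) (auto simp: star_def)

lemma mem_star_PN: "PN n \<in> star V E v \<epsilon> \<longleftrightarrow> n = NV v"
  by (auto simp: star_def)

lemma mem_chat_PI:
  "PI e t \<in> chat V E \<epsilon> X \<omega> \<longleftrightarrow> e \<in> all_edges V E \<and>
    (let inC = node_in V E X (end_comp V E X \<omega>) in
      inC (fst e) \<and> inC (snd e) \<and> 0 < t \<and> t < 1 \<or>
      inC (fst e) \<and> \<not> inC (snd e) \<and> 0 < t \<and> t < \<epsilon> \<or>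
      \<not> inC (fst e) \<and> inC (snd e) \<and> 1 - \<epsilon> < t \<and> t < 1)"
  by (cases e) (auto simp: chat_def Let_def)

lemma mem_chat_PN:
  "PN n \<in> chat V E \<epsilon> X \<omega> \<longleftrightarrow> n \<in> nodes V E \<and> node_in V E X (end_comp V E X \<omega>) n"
  by (auto simp: chat_def Let_def)

lemma mem_edge_nbhd_PI:
  "PI e t \<in> edge_nbhd V E P \<epsilon> z \<longleftrightarrow> e \<in> all_edges V E \<and> P e \<and> \<bar>t - z\<bar> < \<epsilon>"
  by (cases e) (auto simp: edge_nbhd_def)

lemma mem_edge_nbhd_PN: "PN n \<notin> edge_nbhd V E P \<epsilon> z"
  by (auto simp: edge_nbhd_def)

lemmas mem_basic =
  mem_star_PI mem_star_PN mem_chat_PI mem_chat_PN mem_edge_nbhd_PI mem_edge_nbhd_PN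

lemma topspace_DTop: "topspace (DTop V E) = \<Union>(dtop_basis V E)"
  by (simp add: DTop_def)

lemma star_in_dtop_basis:
  assumes "v \<in> V" "0 < \<epsilon>" "\<epsilon> < 1"
  shows "star V E v \<epsilon> \<in> dtop_basis V E"
  unfolding dtop_basis_def
  by (rule UnI1, rule UnI1, rule UnI1, rule UnI1, rule UnI1, rule CollectI) (use assms in blast)

lemma chat_in_dtop_basis:
  assumes "\<omega> \<in> ends V E" "X \<in> fin_subsets V" "0 < \<epsilon>" "\<epsilon> < 1"
  shows "chat V E \<epsilon> X \<omega> \<in> dtop_basis V E"
  unfolding dtop_basis_def
  by (rule UnI1, rule UnI1, rule UnI1, rule UnI2, rule CollectI) (use assms in blast)

text \<open>For a limit edge at \<open>v\<close> the set \<open>{v}\<close> is deleted, and for two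
  ends a set separating them. A neighbourhood free of nodes places the point in the space and also
  gives a member of a cover that contains no chosen vertex.\<close>

lemma inner_point_nbhd:
  assumes e: "e \<in> all_edges V E" and dig: "digraph V E" and t: "0 < t" "t < 1"
  shows "\<exists>B\<in>dtop_basis V E. PI e t \<in> B \<and> (\<forall>n. PN n \<notin> B)"
proof -
  define \<epsilon> where "\<epsilon> = min t (1 - t)"
  have \<epsilon>: "0 < \<epsilon>" "\<epsilon> \<le> min t (1 - t)" using t by (auto simp: \<epsilon>_def)
  have fin: "{v} \<in> fin_subsets V" if "v \<in> V" for v using that by (simp add: fin_subsets_def)
  obtain a b where ab: "e = (a, b)" by (cases e)
  show ?thesis
  proof (cases a)
    case a: (NV v)
    show ?thesis
    proof (cases b)
      case b: (NV w)
      then have "v \<in> V" "w \<in> V" using e dig a ab by (auto simp: mem_all_edges digraph_def)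
      then have "{PI e s | s. 0 < s \<and> s < 1} \<in> dtop_basis V E"
        unfolding dtop_basis_def
        by - (rule UnI1, rule UnI1, rule UnI1, rule UnI1, rule UnI2, rule CollectI,
          rule exI[of _ e], rule exI[of _ 0], rule exI[of _ 1], use e ab a b in simp)
      then show ?thesis using t by (intro bexI[of _ "{PI e s | s. 0 < s \<and> s < 1}"]) auto
    next
      case b: (NE \<omega>)
      then have *: "(NV v, NE \<omega>) \<in> limit_edges V E" "\<omega> \<in> ends V E" "{v} \<in> fin_subsets V"
        using e a ab fin by (auto simp: mem_all_edges mem_limit_edges)
      let ?B = "edge_nbhd V E (\<lambda>e. fst e = NV v \<and> node_in V E {v} (end_comp V E {v} \<omega>) (snd e)) \<epsilon> t"
      have "?B \<in> dtop_basis V E"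
        unfolding dtop_basis_def
        by (rule UnI1, rule UnI2, rule CollectI) (use * t \<epsilon> in blast)
      then show ?thesis
        using e a b ab \<epsilon> * by (intro bexI[of _ ?B]) (auto simp: mem_basic node_in_end_comp)
    qed
  next
    case a: (NE \<omega>)
    show ?thesis
    proof (cases b)
      case b: (NV v)
      then have *: "(NE \<omega>, NV v) \<in> limit_edges V E" "\<omega> \<in> ends V E" "{v} \<in> fin_subsets V"
        using e a ab fin by (auto simp: mem_all_edges mem_limit_edges)
      let ?B = "edge_nbhd V E (\<lambda>e. node_in V E {v} (end_comp V E {v} \<omega>) (fst e) \<and> snd e = NV v) \<epsilon> t"
      have "?B \<in> dtop_basis V E"
        unfolding dtop_basis_def
        by (rule UnI2, rule CollectI) (use * t \<epsilon> in blast)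
      then show ?thesis
        using e a b ab \<epsilon> * by (intro bexI[of _ ?B]) (auto simp: mem_basic node_in_end_comp)
    next
      case b: (NE \<eta>)
      then have *: "(NE \<omega>, NE \<eta>) \<in> limit_edges V E" "\<omega> \<in> ends V E" "\<eta> \<in> ends V E" "\<omega> \<noteq> \<eta>"
        using e a ab by (auto simp: mem_all_edges mem_limit_edges)
      then obtain X where X: "X \<in> fin_subsets V" "end_comp V E X \<omega> \<noteq> end_comp V E X \<eta>"
        using ends_separated by metis
      let ?B = "edge_nbhd V E (\<lambda>e. node_in V E X (end_comp V E X \<omega>) (fst e) \<and>
                           node_in V E X (end_comp V E X \<eta>) (snd e)) \<epsilon> t"
      have "?B \<in> dtop_basis V E"
        unfolding dtop_basis_def
        by (rule UnI1, rule UnI1, rule UnI2, rule CollectI) (use * X t \<epsilon> in blast)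
      then show ?thesis
        using e a b ab \<epsilon> * by (intro bexI[of _ ?B]) (auto simp: mem_basic node_in_end_comp)
    qed
  qed
qed

section \<open>Convergence of ultrafilters\<close>

text \<open>The endpoints of a limit edge are in different components here, so its definition
  supplies an edge of the digraph. Ordinary and limit edges can thus be treated alike when passing
  to a limit.\<close>

lemma mem_all_edges_node_in_pair:
  assumes "e \<in> all_edges V E" "X \<in> fin_subsets V" "C \<in> scomps V E X" "D \<in> scomps V E X" "C \<noteq> D"
    "node_in V E X C (fst e)" "node_in V E X D (snd e)"
  shows "\<exists>u w. (u, w) \<in> E \<and> u \<in> C \<and> w \<in> D"
proof -
  have disj: "\<not> (u \<in> C \<and> u \<in> D)" for u
    using assms(3-5) scomps_disjoint by metis
  obtain a b where "e = (a, b)" by (cases e)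
  with assms disj show ?thesis
    by (cases a; cases b) (fastforce simp: node_in_def mem_all_edges mem_limit_edges)+
qed

lemma mem_all_edges_node_in_head:
  assumes "e \<in> all_edges V E" "X \<in> fin_subsets V" "fst e = NV v" "node_in V E X C (snd e)" "v \<notin> C"
  shows "\<exists>w. (v, w) \<in> E \<and> w \<in> C"
proof -
  obtain b where "e = (NV v, b)" using assms(3) by (cases e) simp
  with assms show ?thesis
    by (cases b) (auto simp: node_in_def mem_all_edges mem_limit_edges)
qed

lemma mem_all_edges_node_in_tail:
  assumes "e \<in> all_edges V E" "X \<in> fin_subsets V" "node_in V E X C (fst e)" "snd e = NV v" "v \<notin> C"
  shows "\<exists>u. (u, v) \<in> E \<and> u \<in> C"
proof -
  obtain a where "e = (a, NV v)" using assms(4) by (cases e) simp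
  with assms show ?thesis
    by (cases a) (auto simp: node_in_def mem_all_edges mem_limit_edges)
qed

text \<open>For a given \<open>X\<close>, the edges eventually join the component of one limit to
  that of the other, and a single one of them yields the edge of the digraph that is demanded. Two
  vertex limits make the edge eventually constant. Equal ends remain as the exception, since limit
  edges join distinct ends.\<close>

lemma node_limit_all_edges:
  assumes F: "ultra F" and ev: "eventually (\<lambda>x. e x \<in> all_edges V E) F"
    and a: "node_limit V E F (\<lambda>x. fst (e x)) a" "a \<in> nodes V E"
    and b: "node_limit V E F (\<lambda>x. snd (e x)) b" "b \<in> nodes V E"
  shows "(a, b) \<in> all_edges V E \<or> (\<exists>\<omega>. a = NE \<omega> \<and> b = NE \<omega>)"
proof (cases a)
  case av: (NV v)
  then have v: "v \<in> V" using a(2) by (auto simp: nodes_def)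
  have eva: "eventually (\<lambda>x. fst (e x) = NV v) F" using node_limit_eq[OF a(1) av] .
  show ?thesis
  proof (cases b)
    case bw: (NV w)
    then have "eventually (\<lambda>x. snd (e x) = NV w) F" by (rule node_limit_eq[OF b(1)])
    with ev eva have "eventually (\<lambda>x. (NV v, NV w) \<in> all_edges V E) F"
      by eventually_elim (metis prod.collapse)
    then show ?thesis using ultra_ex[OF F] av bw by blast
  next
    case bw: (NE \<omega>)
    then have \<omega>: "\<omega> \<in> ends V E" using b(2) by (auto simp: nodes_def)
    have "\<exists>w. (v, w) \<in> E \<and> w \<in> end_comp V E X \<omega>"
      if X: "X \<in> fin_subsets V" and notin: "v \<notin> end_comp V E X \<omega>" for X
    proof -
      have "eventually (\<lambda>x. node_in V E X (end_comp V E X \<omega>) (snd (e x))) F"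
        using node_limit_in[OF b(1) X end_comp_scomps[OF \<omega> X]] bw node_in_end_comp[OF \<omega>] by metis
      with ev eva have "eventually (\<lambda>x. \<exists>w. (v, w) \<in> E \<and> w \<in> end_comp V E X \<omega>) F"
        by eventually_elim (rule mem_all_edges_node_in_head[OF _ X _ _ notin])
      then show ?thesis using ultra_ex[OF F] by blast
    qed
    then show ?thesis using av bw v \<omega> by (simp add: mem_all_edges mem_limit_edges)
  qed
next
  case av: (NE \<eta>)
  then have \<eta>: "\<eta> \<in> ends V E" using a(2) by (auto simp: nodes_def)
  have eva: "eventually (\<lambda>x. node_in V E X (end_comp V E X \<eta>) (fst (e x))) F"
    if X: "X \<in> fin_subsets V" for X
    using node_limit_in[OF a(1) X end_comp_scomps[OF \<eta> X]] av node_in_end_comp[OF \<eta>] by metis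
  show ?thesis
  proof (cases b)
    case bw: (NV w)
    then have w: "w \<in> V" using b(2) by (auto simp: nodes_def)
    have evb: "eventually (\<lambda>x. snd (e x) = NV w) F" using node_limit_eq[OF b(1) bw] .
    have "\<exists>u. (u, w) \<in> E \<and> u \<in> end_comp V E X \<eta>"
      if X: "X \<in> fin_subsets V" and notin: "w \<notin> end_comp V E X \<eta>" for X
    proof -
      from ev eva[OF X] evb have "eventually (\<lambda>x. \<exists>u. (u, w) \<in> E \<and> u \<in> end_comp V E X \<eta>) F"
        by eventually_elim (rule mem_all_edges_node_in_tail[OF _ X _ _ notin])
      then show ?thesis using ultra_ex[OF F] by blast
    qed
    then show ?thesis using av bw w \<eta> by (simp add: mem_all_edges mem_limit_edges)
  next
    case bw: (NE \<omega>)
    then have \<omega>: "\<omega> \<in> ends V E" using b(2) by (auto simp: nodes_def)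
    have "\<exists>u w. (u, w) \<in> E \<and> u \<in> end_comp V E X \<eta> \<and> w \<in> end_comp V E X \<omega>"
      if X: "X \<in> fin_subsets V" and ne: "end_comp V E X \<eta> \<noteq> end_comp V E X \<omega>" for X
    proof -
      have "eventually (\<lambda>x. node_in V E X (end_comp V E X \<omega>) (snd (e x))) F"
        using node_limit_in[OF b(1) X end_comp_scomps[OF \<omega> X]] bw node_in_end_comp[OF \<omega>] by metis
      with ev eva[OF X]
      have "eventually (\<lambda>x. \<exists>u w. (u, w) \<in> E \<and> u \<in> end_comp V E X \<eta> \<and> w \<in> end_comp V E X \<omega>) F"
        by eventually_elim
          (rule mem_all_edges_node_in_pair[OF _ X end_comp_scomps[OF \<eta> X] end_comp_scomps[OF \<omega> X] ne])
      then show ?thesis using ultra_ex[OF F] by blast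
    qed
    then show ?thesis using av bw \<eta> \<omega> by (cases "\<eta> = \<omega>") (simp_all add: mem_all_edges mem_limit_edges)
  qed
qed

section \<open>Convergence of inner points of edges\<close>

context
  fixes V :: "'v set" and E :: "('v \<times> 'v) set" and F :: "'a filter"
    and e :: "'a \<Rightarrow> 'v node \<times> 'v node" and t :: "'a \<Rightarrow> real" and \<tau> :: real and a b :: "'v node"
  assumes edge: "eventually (\<lambda>x. e x \<in> all_edges V E) F"
    and inner: "eventually (\<lambda>x. 0 < t x) F" "eventually (\<lambda>x. t x < 1) F"
    and t: "(t \<longlongrightarrow> \<tau>) F"
    and a: "node_limit V E F (\<lambda>x. fst (e x)) a" "a \<in> nodes V E"
    and b: "node_limit V E F (\<lambda>x. snd (e x)) b" "b \<in> nodes V E"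
begin

text \<open>For a \<open>chat\<close> neighbourhood small coordinates suffice wherever the head is:
  the whole edge belongs to it if the head lies in the component, and the initial segment
  otherwise.\<close>

lemma inner_points_converge_tail:
  assumes "\<tau> = 0" "B \<in> dtop_basis V E" "PN a \<in> B"
  shows "eventually (\<lambda>x. PI (e x) (t x) \<in> B) F"
  using assms(2)
proof (cases rule: dtop_basis_cases)
  case (star v \<epsilon>)
  then have "a = NV v" using assms(3) by (simp add: mem_basic)
  then have "eventually (\<lambda>x. fst (e x) = NV v) F" by (rule node_limit_eq[OF a(1)])
  moreover have "eventually (\<lambda>x. t x < \<epsilon>) F" using order_tendstoD(2)[OF t] assms(1) star by simp
  ultimately show ?thesis
    using edge inner unfolding star by eventually_elim (simp add: mem_basic)
next
  case (chat \<epsilon> X \<omega>)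
  then have "node_in V E X (end_comp V E X \<omega>) a" using assms(3) by (simp add: mem_basic)
  then have "eventually (\<lambda>x. node_in V E X (end_comp V E X \<omega>) (fst (e x))) F"
    using node_limit_in[OF a(1)] end_comp_scomps chat by metis
  moreover have "eventually (\<lambda>x. t x < \<epsilon>) F" using order_tendstoD(2)[OF t] assms(1) chat by simp
  ultimately show ?thesis
    using edge inner unfolding chat by eventually_elim (auto simp: mem_basic Let_def)
qed (use assms(3) in \<open>auto simp: mem_basic\<close>)

lemma inner_points_converge_head:
  assumes "\<tau> = 1" "B \<in> dtop_basis V E" "PN b \<in> B"
  shows "eventually (\<lambda>x. PI (e x) (t x) \<in> B) F"
  using assms(2)
proof (cases rule: dtop_basis_cases)
  case (star v \<epsilon>)
  then have "b = NV v" using assms(3) by (simp add: mem_basic)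
  then have "eventually (\<lambda>x. snd (e x) = NV v) F" by (rule node_limit_eq[OF b(1)])
  moreover have "eventually (\<lambda>x. 1 - \<epsilon> < t x) F" using order_tendstoD(1)[OF t] assms(1) star by simp
  ultimately show ?thesis
    using edge inner unfolding star by eventually_elim (simp add: mem_basic)
next
  case (chat \<epsilon> X \<omega>)
  then have "node_in V E X (end_comp V E X \<omega>) b" using assms(3) by (simp add: mem_basic)
  then have "eventually (\<lambda>x. node_in V E X (end_comp V E X \<omega>) (snd (e x))) F"
    using node_limit_in[OF b(1)] end_comp_scomps chat by metis
  moreover have "eventually (\<lambda>x. 1 - \<epsilon> < t x) F" using order_tendstoD(1)[OF t] assms(1) chat by simp
  ultimately show ?thesis
    using edge inner unfolding chat by eventually_elim (auto simp: mem_basic Let_def)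
qed (use assms(3) in \<open>auto simp: mem_basic\<close>)

text \<open>Tail and head are both eventually in the component, so the whole edge lies in the
  \<open>chat\<close> neighbourhood and every coordinate is allowed.\<close>

lemma inner_points_converge_end:
  assumes "a = NE \<omega>" "b = NE \<omega>" "B \<in> dtop_basis V E" "PN (NE \<omega>) \<in> B"
  shows "eventually (\<lambda>x. PI (e x) (t x) \<in> B) F"
  using assms(3)
proof (cases rule: dtop_basis_cases)
  case (chat \<epsilon> X \<eta>)
  then have "node_in V E X (end_comp V E X \<eta>) (NE \<omega>)" using assms(4) by (simp add: mem_basic)
  then have "eventually (\<lambda>x. node_in V E X (end_comp V E X \<eta>) (fst (e x))) F"
    "eventually (\<lambda>x. node_in V E X (end_comp V E X \<eta>) (snd (e x))) F"
    using node_limit_in[OF a(1)] node_limit_in[OF b(1)] end_comp_scomps chat assms(1,2) by metis+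
  then show ?thesis
    using edge inner unfolding chat by eventually_elim (auto simp: mem_basic Let_def)
qed (use assms(4) in \<open>auto simp: mem_basic\<close>)

lemma inner_points_converge_inner:
  assumes "B \<in> dtop_basis V E" "PI (a, b) \<tau> \<in> B"
  shows "eventually (\<lambda>x. PI (e x) (t x) \<in> B) F"
  using assms(1)
proof (cases rule: dtop_basis_cases)
  case (star v \<epsilon>)
  with assms(2) consider "a = NV v" "\<tau> < \<epsilon>" | "b = NV v" "1 - \<epsilon> < \<tau>" by (auto simp: mem_basic)
  then show ?thesis
  proof cases
    case 1
    have "eventually (\<lambda>x. fst (e x) = NV v) F" using node_limit_eq[OF a(1) 1(1)] .
    moreover have "eventually (\<lambda>x. t x < \<epsilon>) F" using order_tendstoD(2)[OF t] 1 by simp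
    ultimately show ?thesis
      using edge inner unfolding star by eventually_elim (simp add: mem_basic)
  next
    case 2
    have "eventually (\<lambda>x. snd (e x) = NV v) F" using node_limit_eq[OF b(1) 2(1)] .
    moreover have "eventually (\<lambda>x. 1 - \<epsilon> < t x) F" using order_tendstoD(1)[OF t] 2 by simp
    ultimately show ?thesis
      using edge inner unfolding star by eventually_elim (simp add: mem_basic)
  qed
next
  case (interval u w c d)
  then have ab: "a = NV u" "b = NV w" and cd: "c < \<tau>" "\<tau> < d" using assms(2) by auto
  have "eventually (\<lambda>x. fst (e x) = NV u) F" "eventually (\<lambda>x. snd (e x) = NV w) F"
    using node_limit_eq[OF a(1) ab(1)] node_limit_eq[OF b(1) ab(2)] by simp_all
  moreover have "eventually (\<lambda>x. c < t x) F" "eventually (\<lambda>x. t x < d) F"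
    using order_tendstoD[OF t] cd by auto
  ultimately show ?thesis
    unfolding interval by eventually_elim (auto simp: prod_eq_iff)
next
  case (chat \<epsilon> X \<omega>)
  let ?in = "node_in V E X (end_comp V E X \<omega>)"
  have C: "end_comp V E X \<omega> \<in> scomps V E X" using end_comp_scomps chat by metis
  \<comment> \<open>Which clause of \<open>chat\<close> applies depends on the membership of both
    endpoints, so this membership must eventually agree with that of \<open>a\<close> and
    \<open>b\<close>, in the negative as well.\<close>
  have ia: "eventually (\<lambda>x. ?in (fst (e x)) = ?in a) F"
    using node_limit_in[OF a(1) chat(3) C] node_limit_not_in[OF a chat(3) C]
    by (cases "?in a") auto
  have ib: "eventually (\<lambda>x. ?in (snd (e x)) = ?in b) F"
    using node_limit_in[OF b(1) chat(3) C] node_limit_not_in[OF b chat(3) C]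
    by (cases "?in b") auto
  have et: "eventually (\<lambda>x. \<tau> < \<epsilon> \<longrightarrow> t x < \<epsilon>) F" "eventually (\<lambda>x. 1 - \<epsilon> < \<tau> \<longrightarrow> 1 - \<epsilon> < t x) F"
    using order_tendstoD[OF t] by auto
  have "PI (a, b) \<tau> \<in> chat V E \<epsilon> X \<omega>" using assms(2) chat(1) by simp
  then have *: "?in a \<and> ?in b \<or> ?in a \<and> \<not> ?in b \<and> \<tau> < \<epsilon> \<or> \<not> ?in a \<and> ?in b \<and> 1 - \<epsilon> < \<tau>"
    by (auto simp: mem_basic Let_def)
  from ia ib et edge inner show ?thesis
    unfolding chat mem_chat_PI Let_def by eventually_elim (use * in metis)
next
  case (edges P Q \<epsilon> z)
  then have ab: "P a" "Q b" "\<bar>\<tau> - z\<bar> < \<epsilon>" using assms(2) by (auto simp: mem_basic)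
  have "eventually (\<lambda>x. P (fst (e x))) F" "eventually (\<lambda>x. Q (snd (e x))) F"
    using a(1) b(1) ab edges unfolding node_limit_def by blast+
  moreover have "eventually (\<lambda>x. \<bar>t x - z\<bar> < \<epsilon>) F"
    by (rule order_tendstoD(2)[OF _ ab(3)]) (intro tendsto_intros t)
  ultimately show ?thesis
    using edge unfolding edges by eventually_elim (auto simp: mem_basic)
qed

end

section \<open>Points of the space\<close>

lemma PN_in_topspace:
  assumes "n \<in> nodes V E"
  shows "PN n \<in> topspace (DTop V E)"
proof (cases n)
  case (NV v)
  have "star V E v (1/2) \<in> dtop_basis V E"
    using assms NV by (intro star_in_dtop_basis) (auto simp: nodes_def)
  then show ?thesis unfolding topspace_DTop NV by (rule UnionI) (simp add: mem_basic)
next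
  case (NE \<omega>)
  then have \<omega>: "\<omega> \<in> ends V E" using assms by (auto simp: nodes_def)
  have "chat V E (1/2) {} \<omega> \<in> dtop_basis V E"
    using \<omega> by (intro chat_in_dtop_basis) (auto simp: fin_subsets_def)
  then show ?thesis
    unfolding topspace_DTop NE
    by (rule UnionI) (use assms NE \<omega> in \<open>simp add: mem_basic node_in_end_comp\<close>)
qed

lemma topspace_DTop_cases:
  assumes "x \<in> topspace (DTop V E)"
  obtains (PN) n where "x = PN n" "n \<in> nodes V E"
  | (PI) e t where "x = PI e t" "e \<in> all_edges V E" "0 < t" "t < 1"
proof -
  obtain B where B: "B \<in> dtop_basis V E" "x \<in> B" using assms by (auto simp: topspace_DTop)
  have "(\<exists>n\<in>nodes V E. x = PN n) \<or> (\<exists>e\<in>all_edges V E. \<exists>t. x = PI e t \<and> 0 < t \<and> t < 1)"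
    using B(1)
  proof (cases rule: dtop_basis_cases)
    case (star v \<epsilon>)
    then show ?thesis using B(2) by (cases x) (auto simp: mem_basic nodes_def)
  next
    case (interval u w a b)
    then show ?thesis using B(2) by fastforce
  next
    case (chat \<epsilon> X \<omega>)
    then show ?thesis using B(2) by (cases x) (auto simp: mem_basic Let_def)
  next
    \<comment> \<open>The bound on \<open>\<epsilon>\<close> keeps the coordinate strictly between 0
      and 1.\<close>
    case (edges P Q \<epsilon> z)
    then show ?thesis using B(2) by (cases x) (auto simp: mem_basic)
  qed
  then show thesis using PN PI by blast
qed

lemma all_edges_nodes:
  assumes "digraph V E" "e \<in> all_edges V E"
  shows "fst e \<in> nodes V E" "snd e \<in> nodes V E"
proof -
  obtain a b where "e = (a, b)" by (cases e)
  with assms have "fst e \<in> nodes V E \<and> snd e \<in> nodes V E"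
    by (cases a; cases b) (auto simp: mem_all_edges mem_limit_edges nodes_def digraph_def)
  then show "fst e \<in> nodes V E" "snd e \<in> nodes V E" by auto
qed

section \<open>The two implications\<close>

lemma solid_imp_compact_space:
  fixes V :: "'v set" and E :: "('v \<times> 'v) set"
  assumes dig: "digraph V E" and solid: "solid V E"
  shows "compact_space (DTop V E)"
proof (rule compact_space_if_ultra_converge)
  fix F :: "'v dpoint filter"
  assume F: "ultra F" and top: "eventually (\<lambda>x. x \<in> topspace (DTop V E)) F"
  have "\<exists>l\<in>topspace (DTop V E). \<forall>B\<in>dtop_basis V E. l \<in> B \<longrightarrow> eventually (\<lambda>x. x \<in> B) F"
  proof (cases "eventually (\<lambda>x. \<exists>n. x = PN n) F")
    case True
    \<comment> \<open>The value on inner points is arbitrary: the ultrafilter lives on nodes in this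
      case.\<close>
    define p where "p x = (case x of PN n \<Rightarrow> n | PI e t \<Rightarrow> undefined)" for x :: "'v dpoint"
    have p: "eventually (\<lambda>x. x = PN (p x)) F"
      using True by eventually_elim (auto simp: p_def)
    with top have "eventually (\<lambda>x. p x \<in> nodes V E) F"
      by eventually_elim (metis topspace_DTop_cases dpoint.distinct(1) dpoint.inject(1))
    then obtain a where a: "a \<in> nodes V E" "node_limit V E F p a"
      using exists_node_limit[OF solid F] by blast
    have "eventually (\<lambda>x. PN (p x) \<in> B) F" if B: "B \<in> dtop_basis V E" "PN a \<in> B" for B
      using B(1)
    proof (cases rule: dtop_basis_cases)
      case (star v \<epsilon>)
      then have "a = NV v" using B(2) by (simp add: mem_basic)
      then show ?thesis using node_limit_eq[OF a(2)] unfolding star mem_basic by simp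
    next
      case (chat \<epsilon> X \<omega>)
      then have "node_in V E X (end_comp V E X \<omega>) a" using B(2) by (simp add: mem_basic)
      then have "eventually (\<lambda>x. node_in V E X (end_comp V E X \<omega>) (p x)) F"
        using node_limit_in[OF a(2)] end_comp_scomps chat by metis
      then show ?thesis
        using \<open>eventually (\<lambda>x. p x \<in> nodes V E) F\<close> unfolding chat mem_basic
        by (simp add: eventually_conj)
    qed (use B(2) in \<open>auto simp: mem_basic\<close>)
    then have "eventually (\<lambda>x. x \<in> B) F" if "B \<in> dtop_basis V E" "PN a \<in> B" for B
      by (rule eventually_elim2[OF p]) (use that in simp_all)
    then show ?thesis using PN_in_topspace[OF a(1)] by blast
  next
    case False
    then have "eventually (\<lambda>x. \<not> (\<exists>n. x = PN n)) F" using F by (auto simp: ultra_def)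
    with top have pi: "eventually (\<lambda>x. \<exists>e t. x = PI e t \<and> e \<in> all_edges V E \<and> 0 < t \<and> t < 1) F"
      by eventually_elim (metis topspace_DTop_cases)
    define e where "e x = (case x of PN n \<Rightarrow> undefined | PI e t \<Rightarrow> e)" for x :: "'v dpoint"
    define t where "t x = (case x of PN n \<Rightarrow> undefined | PI e t \<Rightarrow> t)" for x :: "'v dpoint"
    have "eventually (\<lambda>x. x = PI (e x) (t x) \<and> e x \<in> all_edges V E \<and> 0 < t x \<and> t x < 1) F"
      using pi by eventually_elim (auto simp: e_def t_def)
    then have x: "eventually (\<lambda>x. x = PI (e x) (t x)) F"
      and edge: "eventually (\<lambda>x. e x \<in> all_edges V E) F"
      and inner: "eventually (\<lambda>x. 0 < t x) F" "eventually (\<lambda>x. t x < 1) F"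
      by (auto simp: eventually_conj_iff)
    have "eventually (\<lambda>x. fst (e x) \<in> nodes V E) F" "eventually (\<lambda>x. snd (e x) \<in> nodes V E) F"
      using edge by (rule eventually_mono, use all_edges_nodes[OF dig] in blast)+
    then obtain a b where a: "node_limit V E F (\<lambda>x. fst (e x)) a" "a \<in> nodes V E"
      and b: "node_limit V E F (\<lambda>x. snd (e x)) b" "b \<in> nodes V E"
      using exists_node_limit[OF solid F] by metis
    have "eventually (\<lambda>x. t x \<in> {0..1}) F" using inner by eventually_elim simp
    then obtain \<tau> where \<tau>: "\<tau> \<in> {0..1}" and t: "(t \<longlongrightarrow> \<tau>) F"
      using ultra_tendsto_compact[OF F compact_Icc] by blast
    have "\<exists>l\<in>topspace (DTop V E). \<forall>B\<in>dtop_basis V E. l \<in> B \<longrightarrow>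
        eventually (\<lambda>x. PI (e x) (t x) \<in> B) F"
    proof -
      \<comment> \<open>A coordinate strictly between 0 and 1 needs an edge \<open>(a, b)\<close> to
        carry it. If both limits are one end, no such edge exists, and the end itself is the
        limit.\<close>
      consider "\<tau> = 0" | "\<tau> = 1" | \<omega> where "a = NE \<omega>" "b = NE \<omega>"
        | "0 < \<tau>" "\<tau> < 1" "(a, b) \<in> all_edges V E"
        using node_limit_all_edges[OF F edge a b] \<tau> by fastforce
      then show ?thesis
      proof cases
        case 1
        then show ?thesis
          using inner_points_converge_tail[OF edge inner t a b] PN_in_topspace[OF a(2)] by blast
      next
        case 2
        then show ?thesis
          using inner_points_converge_head[OF edge inner t a b] PN_in_topspace[OF b(2)] by blast
      next
        case 3
        then show ?thesis
          using inner_points_converge_end[OF edge inner t a b] PN_in_topspace[OF a(2)] by blast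
      next
        case 4
        then have "PI (a, b) \<tau> \<in> topspace (DTop V E)"
          using inner_point_nbhd[OF _ dig] unfolding topspace_DTop by blast
        then show ?thesis
          using inner_points_converge_inner[OF edge inner t a b] by blast
      qed
    qed
    then obtain l where l: "l \<in> topspace (DTop V E)"
      "\<And>B. B \<in> dtop_basis V E \<Longrightarrow> l \<in> B \<Longrightarrow> eventually (\<lambda>x. PI (e x) (t x) \<in> B) F" by blast
    have "eventually (\<lambda>x. x \<in> B) F" if "B \<in> dtop_basis V E" "l \<in> B" for B
      by (rule eventually_elim2[OF x l(2)[OF that]]) simp
    then show ?thesis using l(1) by blast
  qed
  then show "\<exists>l\<in>topspace (DTop V E). \<forall>W. openin (DTop V E) W \<longrightarrow> l \<in> W \<longrightarrow> eventually (\<lambda>x. x \<in> W) F"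
    unfolding DTop_def using eventually_in_open_generated by metis
qed

lemma compact_space_imp_solid:
  fixes V :: "'v set" and E :: "('v \<times> 'v) set"
  assumes dig: "digraph V E" and compact: "compact_space (DTop V E)"
  shows "solid V E"
  unfolding solid_def
proof
  fix X
  assume X: "X \<in> fin_subsets V"
  obtain u where u: "\<And>C. C \<in> scomps V E X \<Longrightarrow> u C \<in> C"
    using scomps_nonempty by (metis ex_in_conv)
  define S where "S = (\<lambda>C. PN (NV (u C)) :: 'v dpoint) ` scomps V E X"
  \<comment> \<open>A finite subcover by sets that each meet \<open>S\<close> at most once makes
    \<open>S\<close> finite.\<close>
  define \<U> where "\<U> = {B \<in> dtop_basis V E. \<forall>x\<in>B \<inter> S. \<forall>y\<in>B \<inter> S. x = y}"
  have inj: "inj_on (\<lambda>C. PN (NV (u C)) :: 'v dpoint) (scomps V E X)"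
  proof (rule inj_onI)
    fix C D
    assume "C \<in> scomps V E X" "D \<in> scomps V E X" "PN (NV (u C)) = (PN (NV (u D)) :: 'v dpoint)"
    then show "C = D" using u[of C] u[of D] scomps_disjoint[of C V E X D "u C"] by simp
  qed
  have "openin (DTop V E) B" if "B \<in> \<U>" for B
    using that unfolding \<U>_def DTop_def by (auto intro: topology_generated_by_Basis)
  moreover have "topspace (DTop V E) \<subseteq> \<Union>\<U>"
  proof
    fix x
    assume "x \<in> topspace (DTop V E)"
    then show "x \<in> \<Union>\<U>"
    proof (cases rule: topspace_DTop_cases)
      case (PN n)
      show ?thesis
      proof (cases n)
        case (NV v)
        have "star V E v (1/2) \<in> dtop_basis V E"
          using PN NV by (intro star_in_dtop_basis) (auto simp: nodes_def)
        then have "star V E v (1/2) \<in> \<U>" by (auto simp: \<U>_def S_def mem_basic)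
        then show ?thesis by (rule UnionI) (simp add: PN NV mem_basic)
      next
        case (NE \<omega>)
        then have \<omega>: "\<omega> \<in> ends V E" using PN by (auto simp: nodes_def)
        \<comment> \<open>The neighbourhood is taken with respect to the given \<open>X\<close>, so
          its vertices lie in one component and include at most one representative. Any radius would
          do in place of 1/2, since \<open>S\<close> contains no inner points.\<close>
        have "chat V E (1/2) X \<omega> \<in> dtop_basis V E"
          using \<omega> X by (intro chat_in_dtop_basis) auto
        moreover have "C = end_comp V E X \<omega>"
          if "C \<in> scomps V E X" "u C \<in> end_comp V E X \<omega>" for C
          using scomps_disjoint[OF that(1) end_comp_scomps[OF \<omega> X] u[OF that(1)] that(2)] .
        then have "u C = u D" if "C \<in> scomps V E X" "D \<in> scomps V E X"
          "u C \<in> end_comp V E X \<omega>" "u D \<in> end_comp V E X \<omega>" for C D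
          using that by metis
        ultimately have "chat V E (1/2) X \<omega> \<in> \<U>"
          by (auto simp: \<U>_def S_def mem_basic node_in_def)
        then show ?thesis
          by (rule UnionI) (use PN NE \<omega> in \<open>simp add: mem_basic node_in_end_comp\<close>)
      qed
    next
      case (PI e t)
      then obtain B where B: "B \<in> dtop_basis V E" "x \<in> B" "\<And>n. PN n \<notin> B"
        using inner_point_nbhd[OF _ dig] by metis
      then have "B \<in> \<U>" by (auto simp: \<U>_def S_def)
      then show ?thesis using B by blast
    qed
  qed
  ultimately obtain \<F> where \<F>: "finite \<F>" "\<F> \<subseteq> \<U>" "topspace (DTop V E) \<subseteq> \<Union>\<F>"
    using compact unfolding compact_space_alt by meson
  have "S \<subseteq> topspace (DTop V E)"
    unfolding S_def using u scomps_subset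
    by (fastforce intro!: PN_in_topspace simp: nodes_def)
  then have "S \<subseteq> (\<Union>B\<in>\<F>. B \<inter> S)" using \<F>(3) by blast
  moreover have "finite (B \<inter> S)" if "B \<in> \<F>" for B
  proof (cases "B \<inter> S = {}")
    case False
    then obtain x where x: "x \<in> B \<inter> S" by blast
    then have "B \<inter> S \<subseteq> {x}" using that \<F>(2) unfolding \<U>_def by blast
    then show ?thesis by (rule finite_subset) simp
  qed simp
  ultimately have "finite S" using \<F>(1) by (meson finite_UN_I finite_subset)
  then show "finite (scomps V E X)" using inj unfolding S_def by (simp add: finite_image_iff)
qed

theorem theorem1:
  fixes V :: "'v set" and E :: "('v \<times> 'v) set"
  assumes "digraph V E"
  shows "compact_space (DTop V E) \<longleftrightarrow> solid V E"
  using assms compact_space_imp_solid solid_imp_compact_space by blast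

end
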